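(* Let $m\ge 3$ and $n\ge1$ be integers. There is a finite set $CS(m,n)$ of positive integers such that for every vector $\mathbf a\in\mathcal N$: $R'_{\mathcal{GP}_m}(\mathbf a)=\mathcal T(n)$ if and only if $R'_{\mathcal{GP}_m}(\mathbf a)\cap\{1,2,\dots,n-1\}=\emptyset$ and $CS(m,n)\subseteq R'_{\mathcal{GP}_m}(\mathbf a)$.
   Context: Let $P_m(x)=\frac{(m-2)x^2-(m-4)x}{2}$ and $\mathcal{GP}_m=\{P_m(u):u\in\mathbb Z\}$ (generalized $m$-gonal numbers). For $k\ge1$ let $\mathcal N(k)=\{(a_1,\dots,a_k)\in\mathbb N^k: a_1\le\cdots\le a_k\}$ ($\mathbb N$ = positive integers) and $\mathcal N=\bigcup_k\mathcal N(k)$. For $\mathbf a=(a_1,\dots,a_k)$ let $R'_{\mathcal{GP}_m}(\mathbf a)=\{a_1s_1+\cdots+a_ks_k:s_i\in\mathcal{GP}_m\}\setminus\{0\}$, the set of nonzero integers represented by $a_1P_m(x_1)+\cdots+a_kP_m(x_k)$. $\mathcal T(n)$ denotes the set of all integers $\ge n$. *)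

theory Defs
  imports Main
begin

text \<open>
  The division by two is exact, see \<open>two_times_polygonal\<close> below.
\<close>

definition polygonal :: "int \<Rightarrow> int \<Rightarrow> int" where
  "polygonal m x = ((m - 2) * x\<^sup>2 - (m - 4) * x) div 2"

lemma two_times_polygonal: "2 * polygonal m x = (m - 2) * x\<^sup>2 - (m - 4) * x"
proof -
  have "even ((m - 2) * x\<^sup>2 - (m - 4) * x)"
    by auto
  then show ?thesis
    unfolding polygonal_def by simp
qed

definition gen_polygonal_numbers :: "int \<Rightarrow> int set" where
  "gen_polygonal_numbers m = range (polygonal m)"

definition coeff_vectors_of_length :: "nat \<Rightarrow> int list set" where
  "coeff_vectors_of_length k = {a. length a = k \<and> sorted a \<and> (\<forall>c\<in>set a. 0 < c)}"

definition coeff_vectors :: "int list set" where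
  "coeff_vectors = (\<Union>k\<in>{1..}. coeff_vectors_of_length k)"

definition nonzero_represented :: "int \<Rightarrow> int list \<Rightarrow> int set" where
  "nonzero_represented m a =
     {\<Sum>i<length a. a ! i * s i | s. \<forall>i<length a. s i \<in> gen_polygonal_numbers m} - {0}"

end

(*
  By escalation and a compactness argument it suffices to show: if the prefixes of an infinite
  sequence of positive coefficients together represent every integer N >= n, then a single prefix
  does. For ten coefficients, a bound on how often the Weyl sums are large gives a sharp moment
  estimate, and so the number of representations of N is close to its average over a short
  progression N + M, N + 2 M, ..., where M is a fixed highly divisible modulus; that average is
  bounded below on the most popular residue class modulo M. Hence ten variables represent all
  large members of one residue class. By Hensel lifting and isotropy over the p-adic numbers some
  prefix represents every residue class for every modulus, so that this prefix followed by ten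
  further variables represents every large integer.
*)

theory Submission
  imports Defs Complex_Main "HOL-Library.FuncSet" "HOL-Library.Multiset" "HOL-Number_Theory.Cong"
begin

section \<open>Distance to the nearest integer and exponentials\<close>

text \<open>The argument is by contradiction rather than through an asymptotic formula: if N has no
  representation, its Fourier sum vanishes and can be subtracted from that of each N + M h. Where a
  Weyl sum is large, the frequency is close to a fraction whose denominator divides M, and there the
  difference nearly cancels. The price is that positivity is known only on a class found by
  pigeonhole; the local argument exists to move from this class to all others.

  Ten is nine plus one. A Weyl sum of length X exceeds \<eta> X on a proportion of order at most
  \<eta>^(-8) X^(-2) of the frequencies, so 9 is the first integer exponent whose moment converges
  to the expected order, and the tenth factor supplies the small \<eta> elsewhere. All constants
  depend on the coefficients, which are unbounded over all vectors; hence compactness instead of a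
  direct bound.\<close>

definition dist_int :: "real \<Rightarrow> real" where
  "dist_int t = \<bar>t - of_int (round t)\<bar>"

lemma dist_int_nonneg: "0 \<le> dist_int t"
  by (simp add: dist_int_def)

lemma dist_int_le: "dist_int t \<le> \<bar>t - of_int k\<bar>"
  unfolding dist_int_def by (rule round_diff_minimal)

lemma dist_int_half: "dist_int t \<le> 1 / 2"
  unfolding dist_int_def using of_int_round_abs_le[of t] by (simp add: abs_minus_commute)

lemma dist_int_add: "dist_int (s + t) \<le> dist_int s + dist_int t"
proof -
  have "dist_int (s + t) \<le> \<bar>s + t - of_int (round s + round t)\<bar>"
    by (rule dist_int_le)
  also have "\<dots> \<le> dist_int s + dist_int t"
    unfolding dist_int_def by simp
  finally show ?thesis .
qed

lemma dist_int_uminus [simp]: "dist_int (- t) = dist_int t"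
proof -
  have "dist_int (- t) \<le> dist_int t" for t
    using dist_int_le[of "- t" "- round t"] unfolding dist_int_def by (simp add: abs_minus_commute)
  from this[of t] this[of "- t"] show ?thesis by simp
qed

lemma dist_int_diff: "dist_int (s - t) \<le> dist_int s + dist_int t"
  using dist_int_add[of s "- t"] by simp

lemma dist_int_of_int_mult: "dist_int (of_int k * t) \<le> \<bar>of_int k\<bar> * dist_int t"
proof -
  have "dist_int (of_int k * t) \<le> \<bar>of_int k * t - of_int (k * round t)\<bar>"
    by (rule dist_int_le)
  also have "\<dots> = \<bar>of_int k\<bar> * dist_int t"
    unfolding dist_int_def by (simp flip: abs_mult add: algebra_simps)
  finally show ?thesis .
qed

lemma dist_int_eq_self:
  assumes "0 \<le> t" "t \<le> 1 / 2"
  shows "dist_int t = t"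
proof -
  have "t \<le> \<bar>t - of_int k\<bar>" for k :: int
  proof (cases "k \<le> 0")
    case True
    then have "real_of_int k \<le> 0" by simp
    then show ?thesis using assms by linarith
  next
    case False
    then have "real_of_int k \<ge> 1" by simp
    then show ?thesis using assms by linarith
  qed
  then have "t \<le> dist_int t"
    unfolding dist_int_def .
  moreover have "dist_int t \<le> t"
    using dist_int_le[of t 0] assms by simp
  ultimately show ?thesis by simp
qed

lemma dist_int_add_int [simp]: "dist_int (t + of_int k) = dist_int t"
proof -
  have "dist_int (t + of_int k) \<le> dist_int t" for t k
    using dist_int_le[of "t + of_int k" "round t + k"] unfolding dist_int_def by simp
  from this[of t k] this[of "t + of_int k" "- k"] show ?thesis by simp
qed

definition unit_exp :: "real \<Rightarrow> complex" where
  "unit_exp t = cis (2 * pi * t)"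

lemma norm_unit_exp [simp]: "cmod (unit_exp t) = 1"
  by (simp add: unit_exp_def)

lemma unit_exp_add: "unit_exp (s + t) = unit_exp s * unit_exp t"
  by (simp add: unit_exp_def cis_mult algebra_simps)

lemma unit_exp_0 [simp]: "unit_exp 0 = 1"
  by (simp add: unit_exp_def)

lemma cnj_unit_exp: "cnj (unit_exp t) = unit_exp (- t)"
  by (simp add: unit_exp_def cis_cnj)

lemma unit_exp_of_int [simp]: "unit_exp (of_int k) = 1"
  by (simp add: unit_exp_def cis_multiple_2pi)

lemma unit_exp_sum: "finite A \<Longrightarrow> unit_exp (\<Sum>i\<in>A. f i) = (\<Prod>i\<in>A. unit_exp (f i))"
  by (induction A rule: finite_induct) (auto simp: unit_exp_add)

lemma unit_exp_of_nat_mult: "unit_exp (of_nat n * t) = unit_exp t ^ n"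
  by (simp add: unit_exp_def DeMoivre algebra_simps)

lemma norm_unit_exp_minus_one: "cmod (unit_exp t - 1) = 2 * \<bar>sin (pi * t)\<bar>"
proof -
  have "(cmod (unit_exp t - 1))\<^sup>2 = (cos (2 * pi * t) - 1)\<^sup>2 + (sin (2 * pi * t))\<^sup>2"
    unfolding unit_exp_def cmod_power2 by simp
  also have "\<dots> = 2 - 2 * cos (2 * (pi * t))"
    using sin_cos_squared_add[of "2 * pi * t"] by (simp add: power2_eq_square algebra_simps)
  also have "\<dots> = (2 * \<bar>sin (pi * t)\<bar>)\<^sup>2"
    unfolding cos_double_sin by (simp add: power2_eq_square)
  finally show ?thesis
    by (rule power2_eq_imp_eq) auto
qed

lemma unit_exp_minus_round: "unit_exp t = unit_exp (t - of_int (round t))"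
  using unit_exp_add[of "t - of_int (round t)" "of_int (round t)"] by simp

lemma norm_unit_exp_minus_one_le: "cmod (unit_exp t - 1) \<le> 2 * pi * dist_int t"
proof -
  let ?s = "t - of_int (round t)"
  have "cmod (unit_exp t - 1) = 2 * \<bar>sin (pi * ?s)\<bar>"
    by (subst unit_exp_minus_round) (rule norm_unit_exp_minus_one)
  also have "\<dots> \<le> 2 * \<bar>pi * ?s\<bar>"
    using abs_sin_x_le_abs_x by (intro mult_left_mono) auto
  finally show ?thesis
    unfolding dist_int_def by (simp add: abs_mult)
qed

text \<open>A weak Jordan inequality: on this range x <= 2, so the cubic Maclaurin error x^3 / 6 is
  at most 2 x / 3. The constant is good enough for \<open>norm_unit_exp_minus_one_ge\<close> because
  2 pi / 3 >= 1.\<close>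

lemma third_le_sin:
  assumes "0 \<le> x" "x \<le> pi / 2"
  shows "x / 3 \<le> sin (x::real)"
proof -
  have "\<bar>sin x - (\<Sum>m<3. sin_coeff m * x ^ m)\<bar> \<le> inverse (fact 3) * \<bar>x\<bar> ^ 3"
    by (rule Maclaurin_sin_bound)
  moreover have "(\<Sum>m<3. sin_coeff m * x ^ m) = x"
    by (simp add: eval_nat_numeral sin_coeff_def)
  moreover have "\<bar>x\<bar> ^ 3 \<le> 4 * x"
  proof -
    have "x \<le> 2" using assms pi_less_4 by simp
    then have "x ^ 2 \<le> 2 ^ 2" using assms by (intro power_mono) auto
    then have "x * x ^ 2 \<le> x * 4" using assms by (intro mult_left_mono) auto
    then show ?thesis using assms by (simp add: eval_nat_numeral)
  qed
  moreover have "inverse (fact 3) * \<bar>x\<bar> ^ 3 = \<bar>x\<bar> ^ 3 / (6::real)"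
    by (simp add: eval_nat_numeral field_simps)
  ultimately show ?thesis by linarith
qed

lemma norm_unit_exp_minus_one_ge: "dist_int t \<le> cmod (unit_exp t - 1)"
proof -
  define s where "s = t - of_int (round t)"
  define r where "r = \<bar>s\<bar>"
  have "cmod (unit_exp t - 1) = 2 * \<bar>sin (pi * s)\<bar>"
    unfolding s_def by (subst unit_exp_minus_round) (rule norm_unit_exp_minus_one)
  also have "\<bar>sin (pi * s)\<bar> = \<bar>sin (pi * r)\<bar>"
    unfolding r_def by (cases "s \<ge> 0") (simp_all only: abs_of_nonneg abs_of_neg not_le sin_minus mult_minus_right abs_minus_cancel)
  finally have *: "cmod (unit_exp t - 1) = 2 * \<bar>sin (pi * r)\<bar>" .
  have r: "dist_int t = r" "0 \<le> r"
    unfolding dist_int_def r_def s_def by auto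
  have "pi * r / 3 \<le> sin (pi * r)"
    using dist_int_half[of t] r by (intro third_le_sin) (auto simp: field_simps)
  moreover have "2 * r \<le> pi * r"
    using pi_ge_two r by (intro mult_right_mono) auto
  ultimately show ?thesis
    unfolding * r using r(2) by linarith
qed

lemma geometric_unit_exp_bound:
  assumes "dist_int \<phi> > 0"
  shows "cmod (\<Sum>y\<in>{A..<B::int}. unit_exp (\<phi> * of_int y)) \<le> 2 / dist_int \<phi>"
proof -
  have tel: "(unit_exp \<phi> - 1) * (\<Sum>y\<in>{A..<A + int n}. unit_exp (\<phi> * of_int y)) =
      unit_exp (\<phi> * of_int (A + int n)) - unit_exp (\<phi> * of_int A)" for n
  proof (induction n)
    case (Suc n)
    have "{A..<A + int (Suc n)} = insert (A + int n) {A..<A + int n}"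
      by auto
    then have "(\<Sum>y\<in>{A..<A + int (Suc n)}. unit_exp (\<phi> * of_int y)) =
      unit_exp (\<phi> * of_int (A + int n)) + (\<Sum>y\<in>{A..<A + int n}. unit_exp (\<phi> * of_int y))"
      by simp
    moreover have "unit_exp (\<phi> * of_int (A + int (Suc n))) = unit_exp \<phi> * unit_exp (\<phi> * of_int (A + int n))"
      by (simp flip: unit_exp_add add: algebra_simps)
    ultimately show ?case
      using Suc by (simp add: algebra_simps del: of_int_add of_nat_Suc)
  qed simp
  let ?S = "\<Sum>y\<in>{A..<B::int}. unit_exp (\<phi> * of_int y)"
  show ?thesis
  proof (cases "A \<le> B")
    case True
    then have "B = A + int (nat (B - A))" by simp
    then have "(unit_exp \<phi> - 1) * ?S = unit_exp (\<phi> * of_int B) - unit_exp (\<phi> * of_int A)"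
      using tel[of "nat (B - A)"] by metis
    then have "cmod (unit_exp \<phi> - 1) * cmod ?S = cmod (unit_exp (\<phi> * of_int B) - unit_exp (\<phi> * of_int A))"
      by (metis norm_mult)
    also have "\<dots> \<le> 2"
      using norm_triangle_ineq4[of "unit_exp (\<phi> * of_int B)" "unit_exp (\<phi> * of_int A)"] by simp
    finally have "cmod (unit_exp \<phi> - 1) * cmod ?S \<le> 2" .
    moreover have "dist_int \<phi> * cmod ?S \<le> cmod (unit_exp \<phi> - 1) * cmod ?S"
      by (intro mult_right_mono norm_unit_exp_minus_one_ge) auto
    ultimately show ?thesis
      using assms by (simp add: field_simps)
  qed (use assms in simp)
qed

text \<open>The frequencies j / L take the place of the circle in the circle method: integrals
  become sums over j < L, and measures of sets of frequencies become cardinalities.\<close>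

lemma unit_exp_orthogonality:
  fixes d :: int and L :: nat
  assumes "L > 0"
  shows "(\<Sum>j<L. unit_exp (real j * (of_int d / real L))) = (if int L dvd d then of_nat L else 0)"
proof -
  let ?w = "unit_exp (of_int d / real L)"
  have sum: "(\<Sum>j<L. unit_exp (real j * (of_int d / real L))) = (\<Sum>j<L. ?w ^ j)"
    by (simp only: unit_exp_of_nat_mult)
  show ?thesis
  proof (cases "int L dvd d")
    case True
    then obtain k where "d = int L * k" by blast
    then have "of_int d / real L = of_int k"
      using assms by simp
    then have "?w = 1" by (simp only: unit_exp_of_int)
    then show ?thesis using sum True by simp
  next
    case False
    have "?w ^ L = 1"
      using assms by (simp flip: unit_exp_of_nat_mult)
    moreover have "?w \<noteq> 1"
    proof
      assume "?w = 1"
      then have "dist_int (of_int d / real L) \<le> 0"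
        using norm_unit_exp_minus_one_ge[of "of_int d / real L"] by simp
      then have "of_int d / real L = of_int (round (of_int d / real L))"
        unfolding dist_int_def by simp
      then have "of_int d = real_of_int (int L * round (of_int d / real L))"
        using assms by (simp add: field_simps)
      then have "d = int L * round (of_int d / real L)"
        by (simp only: of_int_eq_iff)
      then show False using False by (metis dvd_triv_left)
    qed
    ultimately show ?thesis
      using sum False by (simp add: geometric_sum)
  qed
qed

section \<open>Weyl's inequality for polygonal sums\<close>

lemma polygonal_0 [simp]: "polygonal m 0 = 0"
  using two_times_polygonal[of m 0] by simp

text \<open>The mixed term is linear in each variable; this is why one differencing step turns the
  Weyl sum into geometric sums.\<close>

lemma polygonal_add: "polygonal m (x + y) = polygonal m x + polygonal m y + (m - 2) * x * y"
proof -
  have "2 * polygonal m (x + y) = 2 * (polygonal m x + polygonal m y + (m - 2) * x * y)"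
    unfolding distrib_left two_times_polygonal by (simp add: algebra_simps power2_eq_square)
  then show ?thesis by simp
qed

text \<open>The real quadratic vanishes at 0 and at (m - 4) / (m - 2), a number in [-1, 1), so no
  integer lies strictly between its roots.\<close>

lemma polygonal_nonneg:
  assumes "m \<ge> 3"
  shows "0 \<le> polygonal m x"
proof -
  have "0 \<le> x * ((m - 2) * x - (m - 4))"
  proof (cases "x \<ge> 1")
    case True
    have "0 \<le> (m - 2) * (x - 1) + 2" using assms True by (intro add_nonneg_nonneg mult_nonneg_nonneg) auto
    then have "0 \<le> (m - 2) * x - (m - 4)" by (simp add: algebra_simps)
    then show ?thesis using True by (intro mult_nonneg_nonneg) auto
  next
    case False
    have "(m - 2) * x - (m - 4) \<le> 0" if "x \<le> -1"
      using that assms mult_left_mono[of x "-1" "m - 2"] by (simp add: algebra_simps)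
    then have "0 \<le> x * ((m - 2) * x - (m - 4))" if "x \<le> -1"
      using that by (intro mult_nonpos_nonpos) auto
    then show ?thesis using False by (cases "x = 0") auto
  qed
  also have "\<dots> = 2 * polygonal m x"
    unfolding two_times_polygonal by (simp add: algebra_simps power2_eq_square)
  finally show ?thesis by simp
qed

lemma polygonal_lower:
  assumes "m \<ge> 3" "x \<ge> 0"
  shows "x\<^sup>2 \<le> 2 * polygonal m x"
proof (cases "x = 0")
  case False
  then have "0 \<le> (m - 3) * (x * (x - 1)) + x" using assms by (intro add_nonneg_nonneg mult_nonneg_nonneg) auto
  then show ?thesis
    unfolding two_times_polygonal by (simp add: algebra_simps power2_eq_square)
qed simp

lemma polygonal_upper:
  assumes "m \<ge> 3" "x \<ge> 0"
  shows "polygonal m x \<le> (m - 2) * x\<^sup>2"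
proof (cases "x = 0")
  case False
  then have "0 \<le> (m - 3) * (x * x) + x * (x - 1) + (m - 3) * x"
    using assms by (intro add_nonneg_nonneg mult_nonneg_nonneg) auto
  then have "2 * polygonal m x \<le> 2 * ((m - 2) * x\<^sup>2)"
    unfolding two_times_polygonal by (simp add: algebra_simps power2_eq_square)
  then show ?thesis by simp
qed simp

definition polygonal_sum :: "int \<Rightarrow> int \<Rightarrow> nat \<Rightarrow> real \<Rightarrow> complex" where
  "polygonal_sum m c X \<alpha> = (\<Sum>x\<in>{0..<int X}. unit_exp (\<alpha> * of_int (c * polygonal m x)))"

text \<open>Squaring out and substituting h = x - y gives the phase c (P(h) + (m - 2) h y) by
  \<open>polygonal_add\<close>. The part depending on h alone has modulus 1 and drops out; the
  interval for y records that both y and y + h lie in the range of summation.\<close>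

lemma weyl_differencing:
  "(cmod (polygonal_sum m c X \<alpha>))\<^sup>2 \<le>
     (\<Sum>h\<in>{- int X<..<int X}. cmod (\<Sum>y\<in>{max 0 (- h)..<min (int X) (int X - h)}.
        unit_exp (\<alpha> * of_int (c * (m - 2)) * of_int h * of_int y)))"
proof -
  let ?A = "{0..<int X}"
  let ?H = "{- int X<..<int X}"
  let ?I = "\<lambda>h. {max 0 (- h)..<min (int X) (int X - h)}"
  let ?P = "polygonal m"
  let ?u = "\<lambda>h. unit_exp (\<alpha> * of_int (c * ?P h))"
  have "complex_of_real ((cmod (polygonal_sum m c X \<alpha>))\<^sup>2) = polygonal_sum m c X \<alpha> * cnj (polygonal_sum m c X \<alpha>)"
    by (rule complex_norm_square)
  also have "\<dots> = (\<Sum>x\<in>?A. \<Sum>y\<in>?A. unit_exp (\<alpha> * of_int (c * (?P x - ?P y))))"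
    unfolding polygonal_sum_def cnj_sum sum_product cnj_unit_exp
    by (intro sum.cong refl) (simp flip: unit_exp_add add: algebra_simps)
  also have "\<dots> = (\<Sum>(x, y)\<in>?A \<times> ?A. unit_exp (\<alpha> * of_int (c * (?P x - ?P y))))"
    by (simp add: sum.cartesian_product)
  also have "\<dots> = (\<Sum>(h, y)\<in>Sigma ?H ?I. ?u h * unit_exp (\<alpha> * of_int (c * (m - 2)) * of_int h * of_int y))"
  proof (rule sum.reindex_bij_witness[of _ "\<lambda>(h, y). (h + y, y)" "\<lambda>(x, y). (x - y, y)"], goal_cases)
    case (5 p)
    obtain x y where p: "p = (x, y)" by (cases p)
    have "?P x - ?P y = ?P (x - y) + (m - 2) * (x - y) * y"
      using polygonal_add[of m "x - y" y] by simp
    then have "c * (?P x - ?P y) = c * ?P (x - y) + c * (m - 2) * (x - y) * y"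
      by (simp only: distrib_left mult.assoc)
    then have "\<alpha> * of_int (c * (?P x - ?P y)) =
      \<alpha> * of_int (c * ?P (x - y)) + \<alpha> * of_int (c * (m - 2)) * of_int (x - y) * of_int y"
      by (simp only: of_int_add of_int_mult distrib_left mult.assoc)
    then show ?case unfolding p by (simp only: unit_exp_add prod.case)
  qed auto
  also have "\<dots> = (\<Sum>h\<in>?H. \<Sum>y\<in>?I h. ?u h * unit_exp (\<alpha> * of_int (c * (m - 2)) * of_int h * of_int y))"
    by (subst sum.Sigma) auto
  also have "\<dots> = (\<Sum>h\<in>?H. ?u h * (\<Sum>y\<in>?I h. unit_exp (\<alpha> * of_int (c * (m - 2)) * of_int h * of_int y)))"
    by (simp only: sum_distrib_left)
  finally have "(cmod (polygonal_sum m c X \<alpha>))\<^sup>2 = cmod \<dots>"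
    by (metis norm_of_real abs_of_nonneg zero_le_power2)
  also have "\<dots> \<le> (\<Sum>h\<in>?H. cmod (?u h * (\<Sum>y\<in>?I h. unit_exp (\<alpha> * of_int (c * (m - 2)) * of_int h * of_int y))))"
    by (rule norm_sum)
  finally show ?thesis
    by (simp only: norm_mult norm_unit_exp mult_1)
qed

text \<open>An inner sum is at most X in any case, and at most 2 / \<tau> = \<eta>^2 X / 4 when its
  frequency is further than \<tau> = 8 / (\<eta>^2 X) from the integers. The fewer than 2 X shifts
  of the second kind give at most half of \<eta>^2 X^2, so the others carry the rest.\<close>

lemma weyl_large_frequencies:
  fixes \<eta> \<alpha> :: real
  assumes "X > 0" "0 < \<eta>" "\<eta> * real X \<le> cmod (polygonal_sum m c X \<alpha>)"
  shows "\<eta>\<^sup>2 / 2 * X \<le> card {h\<in>{- int X<..<int X}.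
    dist_int (\<alpha> * of_int (c * (m - 2)) * of_int h) \<le> 8 / (\<eta>\<^sup>2 * X)}"
proof -
  let ?\<tau> = "8 / (\<eta>\<^sup>2 * X)"
  let ?H = "{- int X<..<int X}"
  let ?I = "\<lambda>h. {max 0 (- h)..<min (int X) (int X - h)}"
  let ?\<phi> = "\<lambda>h. \<alpha> * of_int (c * (m - 2)) * real_of_int h"
  let ?G = "{h\<in>?H. dist_int (?\<phi> h) \<le> ?\<tau>}"
  let ?T = "\<lambda>h. cmod (\<Sum>y\<in>?I h. unit_exp (?\<phi> h * of_int y))"
  have \<tau>: "?\<tau> > 0" using assms by simp
  have T1: "?T h \<le> X" for h
  proof -
    have "?T h \<le> (\<Sum>y\<in>?I h. cmod (unit_exp (?\<phi> h * of_int y)))"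
      by (rule norm_sum)
    also have "\<dots> = card (?I h)" by simp
    also have "\<dots> \<le> X" by auto
    finally show ?thesis .
  qed
  have T2: "?T h \<le> \<eta>\<^sup>2 * X / 4" if "h \<in> ?H - ?G" for h
  proof -
    have d: "dist_int (?\<phi> h) > ?\<tau>" using that by auto
    have "?T h \<le> 2 / dist_int (?\<phi> h)"
      using d \<tau> by (intro geometric_unit_exp_bound) linarith
    also have "\<dots> \<le> 2 / ?\<tau>"
      by (intro divide_left_mono mult_pos_pos) (use d \<tau> in linarith)+
    also have "\<dots> = \<eta>\<^sup>2 * X / 4"
      using assms by (simp add: field_simps)
    finally show ?thesis .
  qed
  have "\<eta>\<^sup>2 * X * X = (\<eta> * real X)\<^sup>2"
    by (simp add: power2_eq_square algebra_simps)
  also have "\<dots> \<le> (cmod (polygonal_sum m c X \<alpha>))\<^sup>2"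
    using assms by (intro power_mono) auto
  also have "\<dots> \<le> (\<Sum>h\<in>?H. ?T h)"
    by (rule weyl_differencing)
  also have "\<dots> = (\<Sum>h\<in>?G. ?T h) + (\<Sum>h\<in>?H - ?G. ?T h)"
    by (subst sum.subset_diff[of ?G]) auto
  also have "\<dots> \<le> real (card ?G) * real X + real (card (?H - ?G)) * (\<eta>\<^sup>2 * X / 4)"
    by (intro add_mono sum_bounded_above T1) (erule T2)
  finally have le: "\<eta>\<^sup>2 * X * X \<le> real (card ?G) * real X + real (card (?H - ?G)) * (\<eta>\<^sup>2 * X / 4)" .
  have "real (card (?H - ?G)) * (\<eta>\<^sup>2 * X / 4) \<le> real (2 * X) * (\<eta>\<^sup>2 * X / 4)"
  proof (intro mult_right_mono of_nat_mono)
    have "card (?H - ?G) \<le> card ?H" by (intro card_mono) auto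
    also have "card ?H \<le> 2 * X" by simp
    finally show "card (?H - ?G) \<le> 2 * X" .
  qed simp
  with le have *: "\<eta>\<^sup>2 * X * X \<le> real (card ?G) * real X + real (2 * X) * (\<eta>\<^sup>2 * X / 4)"
    by linarith
  define N where "N = real (card ?G)"
  have "X * (\<eta>\<^sup>2 * X / 2) \<le> X * N"
    using * unfolding N_def [symmetric] by (simp add: algebra_simps)
  then have "\<eta>\<^sup>2 * X / 2 \<le> N"
    using assms(1) by (simp only: mult_le_cancel_left_pos of_nat_0_less_iff)
  then show ?thesis unfolding N_def by simp
qed

section \<open>Diophantine approximation: many small multiples force a small denominator\<close>

lemma card_le_of_multiples:
  fixes F :: "int set" and r :: real
  assumes "finite F" "q > 0" "0 \<le> r"
    and "\<And>h h'. h \<in> F \<Longrightarrow> h' \<in> F \<Longrightarrow> h < h' \<Longrightarrow> \<exists>k. h' - h = q * k \<and> of_int k \<le> r"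
  shows "card F \<le> r + 1"
proof (cases "F = {}")
  case False
  define h0 where "h0 = Min F"
  have h0: "h0 \<in> F" "\<And>h. h \<in> F \<Longrightarrow> h0 \<le> h"
    using False assms(1) unfolding h0_def by auto
  have ex: "\<exists>k. h - h0 = q * k \<and> of_int k \<le> r" if "h \<in> F" for h
  proof (cases "h = h0")
    case True
    then show ?thesis using assms(3) by (intro exI[of _ 0]) auto
  next
    case False
    then show ?thesis using assms(4)[of h0 h] h0 that by force
  qed
  have "F \<subseteq> (\<lambda>k. h0 + q * k) ` {0..\<lfloor>r\<rfloor>}"
  proof
    fix h assume h: "h \<in> F"
    then obtain k where k: "h - h0 = q * k" "of_int k \<le> r" using ex by blast
    have "0 \<le> q * k" using h0(2)[OF h] k by simp
    then have "0 \<le> k" using assms(2) by (simp add: zero_le_mult_iff)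
    then show "h \<in> (\<lambda>k. h0 + q * k) ` {0..\<lfloor>r\<rfloor>}"
      using k by (intro image_eqI[of _ _ k]) (auto simp: le_floor_iff)
  qed
  then have "card F \<le> card {0..\<lfloor>r\<rfloor>}"
    by (meson card_image_le card_mono finite_atLeastAtMost_int finite_imageI order_trans)
  also have "real \<dots> \<le> r + 1"
    using assms(3) by simp
  finally show ?thesis by simp
qed (use assms(3) in simp)

text \<open>As long as k steps stay within 1 / 2 there is no wrapping around, so
  \<open>dist_int_of_int_mult\<close> is an equality. This converts a small \<open>dist_int\<close>
  of a multiple into a bound for k.\<close>

lemma dist_int_mult_eq:
  assumes "0 \<le> k" "of_int k * dist_int \<theta> \<le> 1 / 2"
  shows "dist_int (of_int k * \<theta>) = of_int k * dist_int \<theta>"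
proof -
  define t where "t = \<theta> - of_int (round \<theta>)"
  have "of_int k * \<theta> = of_int k * t + of_int (k * round \<theta>)"
    unfolding t_def by (simp add: algebra_simps)
  then have "dist_int (of_int k * \<theta>) = dist_int (of_int k * t)"
    by (metis dist_int_add_int)
  also have "\<dots> = dist_int (of_int k * \<bar>t\<bar>)"
    by (cases "t \<ge> 0") auto
  also have "\<bar>t\<bar> = dist_int \<theta>"
    unfolding t_def dist_int_def ..
  finally show ?thesis
    using assms by (metis dist_int_eq_self dist_int_nonneg mult_nonneg_nonneg of_int_0_le_iff)
qed

text \<open>
  A difference of two close elements of \<open>G\<close> serves as denominator \<open>q\<close>. Along a residue class
  modulo \<open>q\<close> the multiples of \<open>\<theta>\<close> move by steps of size \<open>dist_int (q * \<theta>)\<close>, so a step much larger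
  than claimed would leave too few elements in \<open>G\<close>.
\<close>

lemma rational_approximation_of_many_small:
  fixes G :: "int set" and \<delta> \<tau> \<theta> :: real
  assumes G: "G \<subseteq> {- int X<..<int X}" "\<And>h. h \<in> G \<Longrightarrow> dist_int (\<theta> * of_int h) \<le> \<tau>"
    and card: "\<delta> * X \<le> card G" and \<delta>: "0 < \<delta>" "\<delta> \<le> 1" "2 < \<delta> * X" and \<tau>: "0 < \<tau>" "64 * \<tau> \<le> \<delta>"
  shows "\<exists>q::nat. 1 \<le> q \<and> q \<le> 8 / \<delta> \<and> dist_int (\<theta> * q) \<le> 64 * \<tau> / (\<delta>\<^sup>2 * X)"
proof -
  have X: "X > 0" using \<delta> by (cases X) auto
  have finG: "finite G" using G(1) finite_subset by blast
  \<comment> \<open>Blocks of length g: there are at most 2 X / g + 1 <= \<delta> X / 2 + 1 <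
    \<delta> X of them, so two elements of \<open>G\<close> share a block and differ by less than g
    <= 8 / \<delta>.\<close>
  define g where "g = \<lceil>4 / \<delta>\<rceil>"
  have g: "4 / \<delta> \<le> g" "g \<le> 8 / \<delta>" "g > 0"
  proof -
    show "4 / \<delta> \<le> g" unfolding g_def by linarith
    have "g < 4 / \<delta> + 1" unfolding g_def by linarith
    moreover have "1 \<le> 4 / \<delta>" using \<delta> by (simp add: field_simps)
    ultimately show "g \<le> 8 / \<delta>" by simp
    show "g > 0" using \<open>1 \<le> 4 / \<delta>\<close> unfolding g_def by linarith
  qed
  have "\<not> inj_on (\<lambda>h. (h + X) div g) G"
  proof
    assume inj: "inj_on (\<lambda>h. (h + X) div g) G"
    have "(\<lambda>h. (h + X) div g) ` G \<subseteq> {0..(2 * int X) div g}"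
    proof clarify
      fix h assume "h \<in> G"
      then have "- int X < h" "h < int X" using G by auto
      then show "(h + X) div g \<in> {0..(2 * int X) div g}"
        using g by (auto intro!: zdiv_mono1 simp: pos_imp_zdiv_nonneg_iff)
    qed
    then have "card G \<le> card {0..(2 * int X) div g}"
      using card_inj_on_le[OF inj] by blast
    also have "\<dots> = nat ((2 * int X) div g + 1)" by simp
    finally have "real (card G) \<le> of_int ((2 * int X) div g) + 1"
      using g by (simp add: le_nat_iff pos_imp_zdiv_nonneg_iff flip: of_nat_le_iff)
    also have "of_int ((2 * int X) div g) \<le> (2 * X) / (g :: real)"
      using real_of_int_div4[of "2 * int X" g] by simp
    also have "(2 * X) / (g :: real) \<le> (2 * X) / (4 / \<delta>)"
      using g \<delta> by (intro divide_left_mono) auto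
    also have "\<dots> = \<delta> * X / 2" by simp
    finally show False using card \<delta> by simp
  qed
  then obtain h h' where hh: "h \<in> G" "h' \<in> G" "(h + X) div g = (h' + X) div g" "h < h'"
    unfolding inj_on_def by (metis linorder_neqE)
  define q where "q = h' - h"
  have "h' + X = g * ((h + X) div g) + (h' + X) mod g" "h + X = g * ((h + X) div g) + (h + X) mod g"
    using hh(3) by (metis mult_div_mod_eq)+
  moreover have "(h' + X) mod g < g" "0 \<le> (h + X) mod g" using g by auto
  ultimately have q: "0 < q" "q < g"
    using hh(4) unfolding q_def by linarith+
  define \<beta> where "\<beta> = dist_int (\<theta> * q)"
  have \<beta>2: "\<beta> \<le> 2 * \<tau>"
    using dist_int_diff[of "\<theta> * h'" "\<theta> * h"] G(2)[OF hh(1)] G(2)[OF hh(2)]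
    unfolding \<beta>_def q_def by (simp add: algebra_simps)
  have "\<beta> \<le> 64 * \<tau> / (\<delta>\<^sup>2 * X)"
  proof (cases "\<beta> = 0")
    case False
    then have \<beta>: "\<beta> > 0" using dist_int_nonneg unfolding \<beta>_def by (simp add: order_less_le)
    \<comment> \<open>The number of steps of size \<beta> that fit into 1 / 2, the range of
      \<open>dist_int_mult_eq\<close>.\<close>
    define W where "W = \<lfloor>1 / (2 * \<beta>)\<rfloor>"
    have "1 \<le> 1 / (2 * \<beta>)"
      using \<beta> \<beta>2 \<tau> \<delta> by (simp add: field_simps)
    then have W: "1 \<le> W" "W \<le> 1 / (2 * \<beta>)" "1 / (4 * \<beta>) \<le> W"
    proof -
      assume *: "1 \<le> 1 / (2 * \<beta>)"
      show "1 \<le> W" using * unfolding W_def by (simp add: le_floor_iff)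
      show "W \<le> 1 / (2 * \<beta>)" unfolding W_def by linarith
      have "1 / (2 * \<beta>) < W + 1" unfolding W_def by linarith
      moreover have "1 / (2 * \<beta>) = 2 * (1 / (4 * \<beta>))" by simp
      ultimately show "1 / (4 * \<beta>) \<le> W" using \<open>1 \<le> W\<close> by linarith
    qed
    \<comment> \<open>A fibre collects the elements of one class modulo q in one block of length q
      W. Two of them differ by q k with k < W, so k \<beta> <= 2 \<tau> and a fibre has at most 4
      \<tau> / \<beta> elements. There are at most 8 X \<beta> + q fibres, and the product must
      reach \<delta> X; the part 32 \<tau> X is at most half of that, so the part with q bounds
      \<beta>.\<close>
    define \<kappa> where "\<kappa> = (\<lambda>h. (h mod q, (h + X) div (q * W)))"
    let ?B = "{0..<q} \<times> {0..(2 * int X) div (q * W)}"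
    have qW: "q * W > 0" using q W by simp
    have "\<kappa> \<in> G \<rightarrow> ?B"
    proof
      fix h assume "h \<in> G"
      then have "- int X < h" "h < int X" using G by auto
      then show "\<kappa> h \<in> ?B"
        using q qW unfolding \<kappa>_def by (auto intro!: zdiv_mono1 simp: pos_imp_zdiv_nonneg_iff)
    qed
    moreover have "?B \<noteq> {}" using q qW by (auto simp: pos_imp_zdiv_nonneg_iff)
    ultimately obtain y where y: "card (\<kappa> -` {y} \<inter> G) * card ?B \<ge> card G"
      using pigeonhole_card[of \<kappa> G ?B] finG by auto
    have "card (\<kappa> -` {y} \<inter> G) \<le> 2 * \<tau> / \<beta> + 1"
    proof (rule card_le_of_multiples[where q = q])
      fix h h' assume "h \<in> \<kappa> -` {y} \<inter> G" "h' \<in> \<kappa> -` {y} \<inter> G" and lt: "h < h'"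
      then have hG: "h \<in> G" "h' \<in> G" and md: "h' mod q = h mod q" and dv: "(h' + X) div (q * W) = (h + X) div (q * W)"
        by (auto simp: \<kappa>_def)
      from md obtain k where k: "h' - h = q * k"
        by (metis mod_eq_dvd_iff dvdE)
      have "h' + X = (q * W) * ((h + X) div (q * W)) + (h' + X) mod (q * W)"
        "h + X = (q * W) * ((h + X) div (q * W)) + (h + X) mod (q * W)"
        using dv by (metis mult_div_mod_eq)+
      moreover have "(h' + X) mod (q * W) < q * W" "0 \<le> (h + X) mod (q * W)" using qW by auto
      ultimately have "q * k < q * W" using k by linarith
      then have kW: "k < W" using q by simp
      have k0: "0 \<le> k" using k lt q by (metis diff_gt_0_iff_gt less_le_not_le linorder_not_le zero_less_mult_pos)
      have "of_int k * \<beta> \<le> of_int W * \<beta>" using kW \<beta> by (intro mult_right_mono) auto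
      also have "\<dots> \<le> 1 / (2 * \<beta>) * \<beta>" using W \<beta> by (intro mult_right_mono) auto
      also have "\<dots> = 1 / 2" using \<beta> by simp
      finally have "of_int k * \<beta> = dist_int (of_int k * (\<theta> * q))"
        using k0 unfolding \<beta>_def by (intro dist_int_mult_eq [symmetric]) auto
      also have "of_int k * (\<theta> * q) = \<theta> * h' - \<theta> * h"
        using arg_cong[OF k, of "real_of_int"] by (simp add: algebra_simps flip: distrib_left)
      also have "dist_int (\<theta> * h' - \<theta> * h) \<le> 2 * \<tau>"
        using dist_int_diff[of "\<theta> * h'" "\<theta> * h"] G(2)[OF hG(1)] G(2)[OF hG(2)] by simp
      finally have "of_int k \<le> 2 * \<tau> / \<beta>" using \<beta> by (simp add: field_simps)
      then show "\<exists>k. h' - h = q * k \<and> of_int k \<le> 2 * \<tau> / \<beta>" using k by blast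
    qed (use finG q \<tau> \<beta> in auto)
    also have "\<dots> \<le> 4 * \<tau> / \<beta>"
      using \<beta> \<beta>2 by (simp add: field_simps)
    finally have fib: "card (\<kappa> -` {y} \<inter> G) \<le> 4 * \<tau> / \<beta>" .
    have "real (card ?B) = real_of_int q * (of_int ((2 * int X) div (q * W)) + 1)"
      using q qW by (simp add: pos_imp_zdiv_nonneg_iff)
    also have "\<dots> \<le> real_of_int q * ((2 * X) / (q * W) + 1)"
      using q real_of_int_div4[of "2 * int X" "q * W"] by (intro mult_left_mono add_mono) auto
    also have "\<dots> = 2 * X / W + q"
      using q W by (simp add: field_simps)
    also have "\<dots> \<le> 2 * X / (1 / (4 * \<beta>)) + q"
      using W \<beta> by (intro add_mono divide_left_mono) auto
    also have "\<dots> = 8 * X * \<beta> + q" by simp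
    finally have cB: "real (card ?B) \<le> 8 * X * \<beta> + q" .
    have "\<delta> * X \<le> real (card G)" by (fact card)
    also have "\<dots> \<le> real (card (\<kappa> -` {y} \<inter> G)) * real (card ?B)"
      using y by (metis of_nat_le_iff of_nat_mult)
    also have "\<dots> \<le> (4 * \<tau> / \<beta>) * (8 * X * \<beta> + q)"
      using fib cB \<tau> \<beta> by (intro mult_mono) auto
    also have "\<dots> = 32 * \<tau> * X + 4 * \<tau> * q / \<beta>"
      using \<beta> by (simp add: field_simps)
    also have "32 * \<tau> * X \<le> \<delta> / 2 * X"
      using \<tau> by (intro mult_right_mono) auto
    finally have "\<delta> * X / 2 \<le> 4 * \<tau> * q / \<beta>" by (simp add: field_simps)
    then have "\<beta> \<le> 8 * \<tau> * q / (\<delta> * X)"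
      using \<beta> \<delta> X by (simp add: field_simps)
    also have "\<dots> \<le> 8 * \<tau> * (8 / \<delta>) / (\<delta> * X)"
      using q g \<tau> \<delta> X by (intro divide_right_mono mult_left_mono) auto
    also have "\<dots> = 64 * \<tau> / (\<delta>\<^sup>2 * X)"
      by (simp add: power2_eq_square)
    finally show ?thesis .
  qed (use \<tau> in simp)
  then show ?thesis
    using q g unfolding \<beta>_def by (intro exI[of _ "nat q"]) auto
qed

text \<open>\<open>weyl_large_frequencies\<close> feeds
  \<open>rational_approximation_of_many_small\<close> with \<delta> = \<eta>^2 / 2 and \<tau> = 8 /
  (\<eta>^2 X); the hypothesis with 1024 is just 64 \<tau> <= \<delta>. The error decays like
  X^(-2), the scale on which a quadratic phase of length X changes.\<close>

lemma weyl_inverse: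
  fixes \<eta> \<alpha> :: real
  assumes "0 < \<eta>" "\<eta> \<le> 1" "1024 \<le> \<eta> ^ 4 * real X" "\<eta> * real X \<le> cmod (polygonal_sum m c X \<alpha>)"
  shows "\<exists>q::nat. 1 \<le> q \<and> q \<le> 16 / \<eta>\<^sup>2 \<and>
    dist_int (\<alpha> * of_int (c * (m - 2)) * q) \<le> 2048 / (\<eta> ^ 6 * (real X)\<^sup>2)"
proof -
  let ?\<tau> = "8 / (\<eta>\<^sup>2 * X)" and ?\<delta> = "\<eta>\<^sup>2 / 2"
  let ?G = "{h\<in>{- int X<..<int X}. dist_int (\<alpha> * of_int (c * (m - 2)) * of_int h) \<le> ?\<tau>}"
  have X: "X > 0" using assms(3) by (cases X) auto
  have e2: "\<eta>\<^sup>2 \<le> 1" using assms by (simp add: power_le_one)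
  have "\<eta> ^ 4 * X = \<eta>\<^sup>2 * (\<eta>\<^sup>2 * X)"
    by (simp flip: power_add add: mult.assoc [symmetric])
  also have "\<dots> \<le> 1 * (\<eta>\<^sup>2 * X)"
    using e2 by (intro mult_right_mono) auto
  finally have e2X: "1024 \<le> \<eta>\<^sup>2 * X" using assms by simp
  have "\<exists>q::nat. 1 \<le> q \<and> q \<le> 8 / ?\<delta> \<and> dist_int (\<alpha> * of_int (c * (m - 2)) * q) \<le> 64 * ?\<tau> / (?\<delta>\<^sup>2 * X)"
  proof (rule rational_approximation_of_many_small[of ?G])
    show "?\<delta> * X \<le> card ?G"
      by (rule weyl_large_frequencies) (use X assms in auto)
    have "64 * 8 * 2 \<le> \<eta>\<^sup>2 * (\<eta>\<^sup>2 * X)"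
      using assms(3) by (simp flip: power_add add: mult.assoc [symmetric])
    then show "64 * ?\<tau> \<le> ?\<delta>"
      using assms(1) X by (simp add: field_simps)
  qed (use assms e2X e2 X in auto)
  also have "8 / ?\<delta> = 16 / \<eta>\<^sup>2" by simp
  also have "64 * ?\<tau> / (?\<delta>\<^sup>2 * X) = 2048 / (\<eta> ^ 6 * (real X)\<^sup>2)"
    using assms(1) X by (simp add: field_simps eval_nat_numeral)
  finally show ?thesis by simp
qed

section \<open>Moments of polygonal sums\<close>

lemma card_nat_interval_le:
  fixes t r :: real
  assumes "0 \<le> r"
  shows "finite {j::nat. \<bar>real j - t\<bar> \<le> r}" "real (card {j::nat. \<bar>real j - t\<bar> \<le> r}) \<le> 2 * r + 1"
proof -
  let ?J = "{j::nat. \<bar>real j - t\<bar> \<le> r}" and ?I = "{\<lceil>t - r\<rceil>..\<lfloor>t + r\<rfloor>}"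
  have sub: "int ` ?J \<subseteq> ?I"
    by (auto simp: ceiling_le_iff le_floor_iff abs_le_iff)
  then show fin: "finite ?J"
    by (metis finite_atLeastAtMost_int finite_imageD finite_subset inj_on_of_nat)
  have "card ?J = card (int ` ?J)"
    by (simp add: card_image)
  also have "\<dots> \<le> card ?I"
    using sub by (intro card_mono) auto
  finally have "card ?J \<le> nat (\<lfloor>t + r\<rfloor> - \<lceil>t - r\<rceil> + 1)" by simp
  then have "real (card ?J) \<le> real (nat (\<lfloor>t + r\<rfloor> - \<lceil>t - r\<rceil> + 1))" by (rule of_nat_mono)
  also have "\<dots> \<le> 2 * r + 1"
    using assms by linarith
  finally show "real (card ?J) \<le> 2 * r + 1" .
qed

lemma card_dist_int_le:
  fixes \<rho> :: real
  assumes "B > 0" "L > 0" "0 \<le> \<rho>"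
  shows "card {j\<in>{..<L}. dist_int (real j * real B / real L) \<le> \<rho>} \<le> 4 * \<rho> * L + 2 * B"
proof -
  let ?J = "{j\<in>{..<L}. dist_int (real j * real B / real L) \<le> \<rho>}"
  let ?K = "\<lambda>k. {j::nat. \<bar>real j - real k * L / B\<bar> \<le> \<rho> * L / B}"
  have "?J \<subseteq> (\<Union>k\<in>{..B}. ?K k)"
  proof
    fix j assume j: "j \<in> ?J"
    define k where "k = round (real j * real B / real L)"
    have "0 \<le> real j * real B / real L" "real j * real B / real L \<le> B"
      using j assms by (auto simp: field_simps)
    then have "0 \<le> k" "k \<le> int B"
      unfolding k_def using round_mono[of 0 "real j * real B / real L"]
        round_mono[of "real j * real B / real L" "real B"] by auto
    moreover have "\<bar>real j - of_int k * L / B\<bar> \<le> \<rho> * L / B"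
    proof -
      have "real j - of_int k * L / B = (real j * real B / real L - of_int k) * (L / B)"
        using assms by (simp add: field_simps)
      then have "\<bar>real j - of_int k * L / B\<bar> = \<bar>(real j * real B / real L - of_int k) * (L / B)\<bar>"
        by (simp only:)
      also have "\<dots> = dist_int (real j * real B / real L) * (L / B)"
        unfolding dist_int_def k_def by (simp add: abs_mult)
      also have "\<dots> \<le> \<rho> * (L / B)"
        using j by (intro mult_right_mono) auto
      finally show ?thesis by simp
    qed
    ultimately show "j \<in> (\<Union>k\<in>{..B}. ?K k)"
      by (intro UN_I[of "nat k"]) auto
  qed
  then have "card ?J \<le> card (\<Union>k\<in>{..B}. ?K k)"
    using assms by (intro card_mono finite_UN_I card_nat_interval_le) auto
  also have "\<dots> \<le> (\<Sum>k\<in>{..B}. card (?K k))"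
    by (rule card_UN_le) simp
  finally have "real (card ?J) \<le> real (\<Sum>k\<in>{..B}. card (?K k))" by (rule of_nat_mono)
  also have "\<dots> = (\<Sum>k\<in>{..B}. real (card (?K k)))" by simp
  also have "\<dots> \<le> (\<Sum>k\<in>{..B}. 2 * (\<rho> * L / B) + 1)"
    using assms by (intro sum_mono card_nat_interval_le) auto
  also have "\<dots> = (B + 1) * (2 * (\<rho> * L / B) + 1)" by simp
  also have "\<dots> \<le> (2 * B) * (2 * (\<rho> * L / B) + 1)"
    using assms by (intro mult_right_mono) auto
  also have "\<dots> = 4 * \<rho> * L + 2 * B"
    using assms by (simp add: field_simps)
  finally show ?thesis by simp
qed

text \<open>By \<open>weyl_inverse\<close> such a frequency is near a fraction with denominator b q,
  where q <= 16 / \<eta>^2. Each q accounts for O(\<eta>^(-6) L / X^2 + \<eta>^(-2)) frequencies by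
  \<open>card_dist_int_le\<close>, and the number of q gives the last factor \<eta>^(-2). The
  condition X^2 <= L absorbs the term without L.\<close>

lemma card_large_polygonal_sum:
  assumes "m \<ge> 3" "c > 0"
  shows "\<exists>C::real. 0 < C \<and> (\<forall>(X::nat) (L::nat). \<forall>\<eta>>0. X \<ge> 1 \<longrightarrow> X\<^sup>2 \<le> L \<longrightarrow> \<eta> \<le> 1 \<longrightarrow>
    real (card {j\<in>{..<L}. \<eta> * real X \<le> cmod (polygonal_sum m c X (real j / real L))}) \<le> C * (real L / (real X)\<^sup>2) / \<eta> ^ 8)"
proof -
  define b where "b = nat (c * (m - 2))"
  have b: "b > 0" "of_int (c * (m - 2)) = real b"
    using assms unfolding b_def by (auto simp: zero_less_mult_iff)
  \<comment> \<open>1024^2 covers the range \<eta>^4 X < 1024, where counting all L frequencies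
    suffices. It exceeds 131072 = 16 * 4 * 2048 from the other range, whose second term gives 512 b
    = 16 * 2 * 16 b.\<close>
  define C where "C = 1048576 + 512 * real b"
  show ?thesis
  proof (intro exI[of _ C] conjI allI impI)
    show "C > 0" unfolding C_def by simp
  next
    fix X L :: nat and \<eta> :: real
    assume \<eta>: "0 < \<eta>" "\<eta> \<le> 1" and X: "1 \<le> X" and L: "X\<^sup>2 \<le> L"
    let ?J = "{j\<in>{..<L}. \<eta> * real X \<le> cmod (polygonal_sum m c X (real j / real L))}"
    have L0: "L > 0" using X L by (metis le_zero_eq neq0_conv not_one_le_zero power_eq_0_iff)
    have LX: "1 \<le> real L / (real X)\<^sup>2" using L X by (simp flip: of_nat_power)
    show "real (card ?J) \<le> C * (real L / (real X)\<^sup>2) / \<eta> ^ 8"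
    proof (cases "1024 \<le> \<eta> ^ 4 * real X")
      case False
      have "card ?J \<le> card {..<L}" by (intro card_mono) auto
      then have "real (card ?J) \<le> L" by simp
      also have "\<dots> = \<eta> ^ 8 * (real X)\<^sup>2 * (real L / (real X)\<^sup>2) / \<eta> ^ 8" using X \<eta> by simp
      also have "\<eta> ^ 8 * (real X)\<^sup>2 = (\<eta> ^ 4 * real X)\<^sup>2"
        by (simp add: power_mult_distrib flip: power_mult)
      also have "(\<eta> ^ 4 * real X)\<^sup>2 * (real L / (real X)\<^sup>2) / \<eta> ^ 8 \<le> C * (real L / (real X)\<^sup>2) / \<eta> ^ 8"
      proof (intro divide_right_mono mult_right_mono)
        have "(\<eta> ^ 4 * real X)\<^sup>2 \<le> 1024\<^sup>2" using False \<eta> by (intro power_mono) auto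
        then show "(\<eta> ^ 4 * real X)\<^sup>2 \<le> C" unfolding C_def by simp
      qed (use \<eta> in auto)
      finally show ?thesis .
    next
      case True
      let ?\<rho> = "2048 / (\<eta> ^ 6 * (real X)\<^sup>2)"
      define Q where "Q = nat \<lfloor>16 / \<eta>\<^sup>2\<rfloor>"
      have Q: "real Q \<le> 16 / \<eta>\<^sup>2" unfolding Q_def using \<eta> by simp
      let ?K = "\<lambda>q. {j\<in>{..<L}. dist_int (real j * real (b * q) / real L) \<le> ?\<rho>}"
      have "?J \<subseteq> (\<Union>q\<in>{1..Q}. ?K q)"
      proof
        fix j assume j: "j \<in> ?J"
        then obtain q where q: "1 \<le> q" "q \<le> 16 / \<eta>\<^sup>2"
          "dist_int (real j / real L * of_int (c * (m - 2)) * real q) \<le> ?\<rho>"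
          using weyl_inverse[OF \<eta> True, of m c "real j / real L"] by auto
        have "real j / real L * of_int (c * (m - 2)) * real q = real j * real (b * q) / real L"
          unfolding b by simp
        then have "dist_int (real j * real (b * q) / real L) \<le> ?\<rho>"
          using q(3) by (simp only:)
        then have "j \<in> ?K q" using j by blast
        moreover have "q \<le> Q" unfolding Q_def using q by (simp add: le_nat_floor)
        ultimately show "j \<in> (\<Union>q\<in>{1..Q}. ?K q)" using q by auto
      qed
      then have "card ?J \<le> card (\<Union>q\<in>{1..Q}. ?K q)"
        by (intro card_mono) auto
      also have "\<dots> \<le> (\<Sum>q\<in>{1..Q}. card (?K q))"
        by (rule card_UN_le) simp
      finally have "real (card ?J) \<le> real (\<Sum>q\<in>{1..Q}. card (?K q))" by (rule of_nat_mono)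
      also have "\<dots> = (\<Sum>q\<in>{1..Q}. real (card (?K q)))" by simp
      also have "\<dots> \<le> (\<Sum>q\<in>{1..Q}. 4 * ?\<rho> * L + 2 * b * (16 / \<eta>\<^sup>2))"
      proof (intro sum_mono)
        fix q assume q: "q \<in> {1..Q}"
        have "real (card (?K q)) \<le> 4 * ?\<rho> * L + 2 * (b * q)"
          using card_dist_int_le[of "b * q" L ?\<rho>] b q L0 \<eta> by simp
        moreover have "real q \<le> 16 / \<eta>\<^sup>2"
          using q Q by (meson atLeastAtMost_iff of_nat_mono order_trans)
        then have "real b * real q \<le> real b * (16 / \<eta>\<^sup>2)"
          by (intro mult_left_mono) auto
        then have "4 * ?\<rho> * L + 2 * (b * q) \<le> 4 * ?\<rho> * L + 2 * b * (16 / \<eta>\<^sup>2)"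
          by simp
        ultimately show "real (card (?K q)) \<le> 4 * ?\<rho> * L + 2 * b * (16 / \<eta>\<^sup>2)"
          by (rule order_trans)
      qed
      also have "\<dots> = Q * (4 * ?\<rho> * L + 2 * b * (16 / \<eta>\<^sup>2))" by simp
      also have "\<dots> \<le> 16 / \<eta>\<^sup>2 * (4 * ?\<rho> * L + 2 * b * (16 / \<eta>\<^sup>2))"
        using Q \<eta> by (intro mult_right_mono) auto
      also have "\<dots> = (131072 * (real L / (real X)\<^sup>2) + 512 * b * \<eta> ^ 4) / \<eta> ^ 8"
        using \<eta> by (simp add: field_simps eval_nat_numeral)
      also have "\<dots> \<le> C * (real L / (real X)\<^sup>2) / \<eta> ^ 8"
      proof (intro divide_right_mono)
        have "\<eta> ^ 4 \<le> 1" using \<eta> by (simp add: power_le_one)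
        then have "512 * b * \<eta> ^ 4 \<le> 512 * b * (real L / (real X)\<^sup>2)"
          using LX by (intro mult_left_mono) linarith+
        then show "131072 * (real L / (real X)\<^sup>2) + 512 * b * \<eta> ^ 4 \<le> C * (real L / (real X)\<^sup>2)"
          unfolding C_def distrib_right using LX by linarith
      qed (use \<eta> in auto)
      finally show ?thesis .
    qed
  qed
qed

text \<open>On the dyadic level 2^(-K-1) <= f < 2^(-K) the sum is at most A 2^(8 K + 8) 2^(-9 K) =
  256 A 2^(-K), which is summable over K because 9 exceeds the tail exponent 8.\<close>

lemma moment_from_tail:
  fixes f :: "nat \<Rightarrow> real"
  assumes f: "\<And>j. j < L \<Longrightarrow> 0 \<le> f j" "\<And>j. j < L \<Longrightarrow> f j \<le> 1"
    and tail: "\<And>\<eta>. 0 < \<eta> \<Longrightarrow> \<eta> \<le> 1 \<Longrightarrow> real (card {j\<in>{..<L}. \<eta> \<le> f j}) \<le> A / \<eta> ^ 8"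
  shows "(\<Sum>j<L. f j ^ 9) \<le> 1024 * A"
proof -
  have dyadic: "(\<Sum>j\<in>{j\<in>{..<L}. (1/2) ^ K \<le> f j}. f j ^ 9) \<le> 512 * A * (2 - (1/2) ^ K)" for K
  proof (induction K)
    case 0
    have "(\<Sum>j\<in>{j\<in>{..<L}. (1/2) ^ 0 \<le> f j}. f j ^ 9) \<le> real (card {j\<in>{..<L}. (1/2) ^ 0 \<le> f j}) * 1"
      using f by (intro sum_bounded_above) (auto intro: power_le_one)
    also have "\<dots> \<le> A" using tail[of 1] by simp
    finally show ?case using tail[of 1] by simp
  next
    case (Suc K)
    let ?F = "\<lambda>K. {j\<in>{..<L}. (1/2) ^ K \<le> f j}"
    have "(1/2) ^ Suc K \<le> (1/2 :: real) ^ K" by (rule power_decreasing) auto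
    then have sub: "?F K \<subseteq> ?F (Suc K)" by (blast intro: order_trans)
    have "(\<Sum>j\<in>?F (Suc K) - ?F K. f j ^ 9) \<le> real (card (?F (Suc K) - ?F K)) * ((1/2) ^ K) ^ 9"
      using f by (intro sum_bounded_above power_mono) auto
    also have "\<dots> \<le> real (card (?F (Suc K))) * ((1/2) ^ K) ^ 9"
      by (intro mult_right_mono of_nat_mono card_mono) auto
    also have "\<dots> \<le> A / ((1/2) ^ Suc K) ^ 8 * ((1/2) ^ K) ^ 9"
    proof (intro mult_right_mono tail)
      show "(1/2 :: real) ^ Suc K \<le> 1" by (rule power_le_one) auto
    qed auto
    also have "\<dots> = 512 * A * (1/2) ^ Suc K"
      by (simp add: power_divide power_mult_distrib eval_nat_numeral)
    finally have "(\<Sum>j\<in>?F (Suc K) - ?F K. f j ^ 9) \<le> 512 * A * (1/2) ^ Suc K" .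
    moreover have "(\<Sum>j\<in>?F (Suc K). f j ^ 9) = (\<Sum>j\<in>?F (Suc K) - ?F K. f j ^ 9) + (\<Sum>j\<in>?F K. f j ^ 9)"
      using sub by (intro sum.subset_diff) auto
    ultimately have "(\<Sum>j\<in>?F (Suc K). f j ^ 9) \<le> 512 * A * (1/2) ^ Suc K + 512 * A * (2 - (1/2) ^ K)"
      using Suc by linarith
    also have "\<dots> = 512 * A * (2 - (1/2) ^ Suc K)" by (simp add: algebra_simps)
    finally show ?case .
  qed
  have A: "0 \<le> A" using tail[of 1] by (simp add: order_trans[OF of_nat_0_le_iff])
  \<comment> \<open>Points below level K, in particular zeros of f, contribute at most L 2^(-K); L
    is fixed, so this tends to 0.\<close>
  have all: "(\<Sum>j<L. f j ^ 9) \<le> 1024 * A + L * (1/2) ^ K" for K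
  proof -
    let ?F = "{j\<in>{..<L}. (1/2) ^ K \<le> f j}"
    have "(\<Sum>j<L. f j ^ 9) = (\<Sum>j\<in>{..<L} - ?F. f j ^ 9) + (\<Sum>j\<in>?F. f j ^ 9)"
      by (intro sum.subset_diff) auto
    moreover have "(\<Sum>j\<in>{..<L} - ?F. f j ^ 9) \<le> real (card ({..<L} - ?F)) * (1/2) ^ K"
    proof (intro sum_bounded_above)
      fix j assume j: "j \<in> {..<L} - ?F"
      then have "f j ^ 9 \<le> f j ^ 1" using f[of j] by (intro power_decreasing) auto
      then show "f j ^ 9 \<le> (1/2) ^ K" using j by auto
    qed
    moreover have "real (card ({..<L} - ?F)) * (1/2) ^ K \<le> L * (1/2) ^ K"
    proof (intro mult_right_mono of_nat_mono)
      show "card ({..<L} - ?F) \<le> L" using card_mono[of "{..<L}" "{..<L} - ?F"] by simp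
    qed simp
    moreover have "512 * A * (2 - (1/2) ^ K) \<le> 1024 * A"
      using A by (simp add: algebra_simps)
    ultimately show ?thesis using dyadic[of K] by linarith
  qed
  show ?thesis
  proof (rule ccontr)
    assume "\<not> ?thesis"
    then have gap: "0 < (\<Sum>j<L. f j ^ 9) - 1024 * A" by simp
    then have "L > 0" using A by (cases L) auto
    obtain K where "(1/2) ^ K < ((\<Sum>j<L. f j ^ 9) - 1024 * A) / L"
      using real_arch_pow_inv[of "((\<Sum>j<L. f j ^ 9) - 1024 * A) / L" "1/2"] gap \<open>L > 0\<close> by auto
    then show False using all[of K] \<open>L > 0\<close> by (simp add: field_simps)
  qed
qed

lemma norm_polygonal_sum_le: "cmod (polygonal_sum m c X \<alpha>) \<le> X"
proof -
  have "cmod (polygonal_sum m c X \<alpha>) \<le> (\<Sum>x\<in>{0..<int X}. cmod (unit_exp (\<alpha> * of_int (c * polygonal m x))))"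
    unfolding polygonal_sum_def by (rule norm_sum)
  then show ?thesis by simp
qed

text \<open>X^7 L is X^9 times a proportion X^(-2) of the L frequencies. No factor X^\<epsilon> is
  lost, so the bound can be compared with a lower bound of the same order.\<close>

lemma polygonal_sum_moment:
  assumes "m \<ge> 3" "c > 0"
  shows "\<exists>C::real. 0 < C \<and> (\<forall>(X::nat) (L::nat). X \<ge> 1 \<longrightarrow> X\<^sup>2 \<le> L \<longrightarrow>
    (\<Sum>j<L. cmod (polygonal_sum m c X (real j / real L)) ^ 9) \<le> C * real X ^ 7 * real L)"
proof -
  obtain C where C: "C > 0" "\<And>(X::nat) (L::nat) \<eta>. 0 < \<eta> \<Longrightarrow> X \<ge> 1 \<Longrightarrow> X\<^sup>2 \<le> L \<Longrightarrow> \<eta> \<le> 1 \<Longrightarrow>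
    real (card {j\<in>{..<L}. \<eta> * real X \<le> cmod (polygonal_sum m c X (real j / real L))}) \<le> C * (real L / (real X)\<^sup>2) / \<eta> ^ 8"
    using card_large_polygonal_sum[OF assms] by blast
  show ?thesis
  proof (intro exI[of _ "1024 * C"] conjI allI impI)
    fix X L :: nat assume X: "1 \<le> X" and L: "X\<^sup>2 \<le> L"
    let ?f = "\<lambda>j. cmod (polygonal_sum m c X (real j / real L)) / X"
    have "(\<Sum>j<L. ?f j ^ 9) \<le> 1024 * (C * (real L / (real X)\<^sup>2))"
    proof (rule moment_from_tail)
      fix \<eta> :: real assume "0 < \<eta>" "\<eta> \<le> 1"
      then show "real (card {j\<in>{..<L}. \<eta> \<le> ?f j}) \<le> C * (real L / (real X)\<^sup>2) / \<eta> ^ 8"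
        using C(2)[of \<eta> X L] X L by (simp add: field_simps)
    qed (use X in \<open>auto intro: norm_polygonal_sum_le\<close>)
    then have "(\<Sum>j<L. cmod (polygonal_sum m c X (real j / real L)) ^ 9) / real X ^ 9 \<le> 1024 * (C * (real L / (real X)\<^sup>2))"
      by (simp add: power_divide sum_divide_distrib)
    then have "(\<Sum>j<L. cmod (polygonal_sum m c X (real j / real L)) ^ 9) \<le> 1024 * (C * (real L / (real X)\<^sup>2)) * real X ^ 9"
      using X by (simp add: pos_divide_le_eq)
    also have "\<dots> = 1024 * C * real X ^ 7 * real L"
      using X by (simp add: field_simps eval_nat_numeral)
    finally show "(\<Sum>j<L. cmod (polygonal_sum m c X (real j / real L)) ^ 9) \<le> 1024 * C * real X ^ 7 * real L"
      by simp
  qed (use C in auto)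
qed

section \<open>Averaging the number of representations\<close>

text \<open>Coefficients form an infinite sequence of which k selects a prefix, so prefixes of one
  sequence are compared by varying k alone.\<close>

definition form_value :: "int \<Rightarrow> (nat \<Rightarrow> int) \<Rightarrow> nat \<Rightarrow> (nat \<Rightarrow> int) \<Rightarrow> int" where
  "form_value m a k x = (\<Sum>i<k. a i * polygonal m (x i))"

definition box :: "nat \<Rightarrow> nat \<Rightarrow> (nat \<Rightarrow> int) set" where
  "box k X = PiE {..<k} (\<lambda>_. {0..<int X})"

lemma finite_box [simp]: "finite (box k X)"
  unfolding box_def by (intro finite_PiE) auto

definition rep_count :: "int \<Rightarrow> (nat \<Rightarrow> int) \<Rightarrow> nat \<Rightarrow> nat \<Rightarrow> int \<Rightarrow> nat" where
  "rep_count m a k X N = card {x \<in> box k X. form_value m a k x = N}"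

lemma rep_count_fourier:
  assumes "0 \<le> N" "N < int L" "\<And>x. x \<in> box k X \<Longrightarrow> 0 \<le> form_value m a k x \<and> form_value m a k x < int L"
  shows "of_nat (L * rep_count m a k X N) =
    (\<Sum>j<L. (\<Prod>i<k. polygonal_sum m (a i) X (real j / real L)) * unit_exp (real j * (- of_int N / real L)))"
proof -
  let ?Q = "form_value m a k"
  have L: "L > 0" using assms by (cases L) auto
  have "(\<Prod>i<k. polygonal_sum m (a i) X (real j / real L)) * unit_exp (real j * (- of_int N / real L)) =
      (\<Sum>x\<in>box k X. unit_exp (real j * (of_int (?Q x - N) / real L)))" for j
  proof -
    have "(\<Prod>i<k. polygonal_sum m (a i) X (real j / real L)) =
        (\<Sum>x\<in>box k X. \<Prod>i<k. unit_exp (real j / real L * of_int (a i * polygonal m (x i))))"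
      unfolding polygonal_sum_def box_def by (rule prod_sum_PiE) auto
    also have "\<dots> = (\<Sum>x\<in>box k X. unit_exp (real j / real L * of_int (?Q x)))"
      unfolding form_value_def of_int_sum sum_distrib_left by (simp add: unit_exp_sum)
    also have "\<dots> * unit_exp (real j * (- of_int N / real L)) =
        (\<Sum>x\<in>box k X. unit_exp (real j * (of_int (?Q x - N) / real L)))"
      unfolding sum_distrib_right unit_exp_add [symmetric]
      by (intro sum.cong refl arg_cong[where f = unit_exp]) (simp add: diff_divide_distrib algebra_simps)
    finally show ?thesis .
  qed
  then have "(\<Sum>j<L. (\<Prod>i<k. polygonal_sum m (a i) X (real j / real L)) * unit_exp (real j * (- of_int N / real L)))
    = (\<Sum>j<L. \<Sum>x\<in>box k X. unit_exp (real j * (of_int (?Q x - N) / real L)))"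
    by simp
  also have "\<dots> = (\<Sum>x\<in>box k X. \<Sum>j<L. unit_exp (real j * (of_int (?Q x - N) / real L)))"
    by (rule sum.swap)
  also have "\<dots> = (\<Sum>x\<in>box k X. if ?Q x = N then of_nat L else 0)"
  proof (intro sum.cong refl)
    fix x assume "x \<in> box k X"
    then have "\<bar>?Q x - N\<bar> < int L" using assms by (smt (verit))
    then have "int L dvd ?Q x - N \<longleftrightarrow> ?Q x = N"
      using zdvd_not_zless[of "\<bar>?Q x - N\<bar>" "int L"] by auto
    then show "(\<Sum>j<L. unit_exp (real j * (of_int (?Q x - N) / real L))) = (if ?Q x = N then of_nat L else 0)"
      using unit_exp_orthogonality[OF L, of "?Q x - N"] by simp
  qed
  also have "\<dots> = of_nat (L * rep_count m a k X N)"
    unfolding rep_count_def by (simp add: sum.If_cases Int_def)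
  finally show ?thesis by simp
qed

text \<open>
  The moving average over the progression \<open>N + M h\<close> changes the Fourier coefficient at
  \<open>j / L\<close> by a factor that is small when \<open>M j / L\<close> is close to an integer; for all other
  frequencies the exponential sums themselves are small.
\<close>

lemma rep_count_average:
  assumes "0 \<le> N" "N + int (M * H) < int L" "H > 0" "rep_count m a k X N = 0"
    and range: "\<And>x. x \<in> box k X \<Longrightarrow> 0 \<le> form_value m a k x \<and> form_value m a k x < int L"
    and E: "\<And>j. j < L \<Longrightarrow> (\<Prod>i<k. cmod (polygonal_sum m (a i) X (real j / real L))) *
      min 2 (2 * pi * H * dist_int (real M * (real j / real L))) \<le> E j"
  shows "real L * (\<Sum>h\<in>{1..H}. rep_count m a k X (N + int (M * h))) \<le> H * (\<Sum>j<L. E j)"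
proof -
  let ?T = "\<lambda>j. \<Prod>i<k. polygonal_sum m (a i) X (real j / real L)"
  let ?D = "\<lambda>j. \<Sum>h\<in>{1..H}. unit_exp (- (real h * (real M * (real j / real L)))) - 1"
  have D: "cmod (?D j) \<le> H * min 2 (2 * pi * H * dist_int (real M * (real j / real L)))" for j
  proof -
    let ?\<alpha> = "real M * (real j / real L)"
    have "cmod (?D j) \<le> (\<Sum>h\<in>{1..H}. cmod (unit_exp (- (real h * ?\<alpha>)) - 1))"
      by (rule norm_sum)
    also have "\<dots> \<le> (\<Sum>h\<in>{1..H}. min 2 (2 * pi * H * dist_int ?\<alpha>))"
    proof (intro sum_mono min.boundedI)
      fix h assume h: "h \<in> {1..H}"
      show "cmod (unit_exp (- (real h * ?\<alpha>)) - 1) \<le> 2"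
        using norm_triangle_ineq4[of "unit_exp (- (real h * ?\<alpha>))" 1] by simp
      have "dist_int (real h * ?\<alpha>) \<le> real h * dist_int ?\<alpha>"
        using dist_int_of_int_mult[of "int h" ?\<alpha>] by simp
      also have "\<dots> \<le> real H * dist_int ?\<alpha>"
        using h by (intro mult_right_mono dist_int_nonneg) auto
      finally have "2 * pi * dist_int (real h * ?\<alpha>) \<le> 2 * pi * (real H * dist_int ?\<alpha>)"
        by (intro mult_left_mono) auto
      moreover have "cmod (unit_exp (- (real h * ?\<alpha>)) - 1) \<le> 2 * pi * dist_int (real h * ?\<alpha>)"
        using norm_unit_exp_minus_one_le[of "- (real h * ?\<alpha>)"] by (simp only: dist_int_uminus)
      ultimately show "cmod (unit_exp (- (real h * ?\<alpha>)) - 1) \<le> 2 * pi * H * dist_int ?\<alpha>"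
        by linarith
    qed
    finally show ?thesis by simp
  qed
  have L: "N < int L" using assms(1,2) by (smt (verit) of_nat_0_le_iff)
  have shift: "of_nat (L * rep_count m a k X (N + int (M * h))) =
      (\<Sum>j<L. ?T j * unit_exp (real j * (- of_int N / real L)) * unit_exp (- (real h * (real M * (real j / real L)))))"
    if "h \<in> {1..H}" for h
  proof -
    have "int (M * h) \<le> int (M * H)" using that by (intro of_nat_mono mult_left_mono) auto
    then have "of_nat (L * rep_count m a k X (N + int (M * h))) =
      (\<Sum>j<L. ?T j * unit_exp (real j * (- of_int (N + int (M * h)) / real L)))"
      using assms(1,2) range by (intro rep_count_fourier) auto
    also have "\<dots> = (\<Sum>j<L. ?T j * unit_exp (real j * (- of_int N / real L)) * unit_exp (- (real h * (real M * (real j / real L)))))"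
    proof (intro sum.cong refl)
      fix j
      have "real j * (- of_int (N + int (M * h)) / real L) = real j * (- of_int N / real L) + - (real h * (real M * (real j / real L)))"
        by (simp add: add_divide_distrib diff_divide_distrib algebra_simps)
      then show "?T j * unit_exp (real j * (- of_int (N + int (M * h)) / real L)) =
          ?T j * unit_exp (real j * (- of_int N / real L)) * unit_exp (- (real h * (real M * (real j / real L))))"
        by (simp only: unit_exp_add mult.assoc)
    qed
    finally show ?thesis .
  qed
  \<comment> \<open>The absence of representations of N enters here: a vanishing sum may be
    subtracted H times, which turns each shift factor into that factor minus 1.\<close>
  have zero: "(\<Sum>j<L. ?T j * unit_exp (real j * (- of_int N / real L))) = 0"
    using rep_count_fourier[of N L k X m a] assms(1,4) L range by simp
  have "of_nat (L * (\<Sum>h\<in>{1..H}. rep_count m a k X (N + int (M * h)))) =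
      (\<Sum>h\<in>{1..H}. (of_nat (L * rep_count m a k X (N + int (M * h))) :: complex))"
    by (simp add: sum_distrib_left)
  also have "\<dots> = (\<Sum>h\<in>{1..H}. (\<Sum>j<L. ?T j * unit_exp (real j * (- of_int N / real L)) * unit_exp (- (real h * (real M * (real j / real L)))))
      - (\<Sum>j<L. ?T j * unit_exp (real j * (- of_int N / real L))))"
    unfolding zero by (intro sum.cong refl) (simp only: shift diff_zero)
  also have "\<dots> = (\<Sum>h\<in>{1..H}. \<Sum>j<L. ?T j * unit_exp (real j * (- of_int N / real L)) * (unit_exp (- (real h * (real M * (real j / real L)))) - 1))"
    by (simp add: sum_subtractf right_diff_distrib)
  also have "\<dots> = (\<Sum>j<L. \<Sum>h\<in>{1..H}. ?T j * unit_exp (real j * (- of_int N / real L)) * (unit_exp (- (real h * (real M * (real j / real L)))) - 1))"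
    by (rule sum.swap)
  also have "\<dots> = (\<Sum>j<L. ?T j * unit_exp (real j * (- of_int N / real L)) * ?D j)"
    by (simp only: sum_distrib_left)
  finally have eq: "of_nat (L * (\<Sum>h\<in>{1..H}. rep_count m a k X (N + int (M * h)))) =
    (\<Sum>j<L. ?T j * unit_exp (real j * (- of_int N / real L)) * ?D j)" .
  have "real L * (\<Sum>h\<in>{1..H}. rep_count m a k X (N + int (M * h))) =
      cmod (of_nat (L * (\<Sum>h\<in>{1..H}. rep_count m a k X (N + int (M * h)))))"
    by (simp only: norm_of_nat) (simp only: of_nat_mult)
  also have "\<dots> \<le> (\<Sum>j<L. cmod (?T j * unit_exp (real j * (- of_int N / real L)) * ?D j))"
    unfolding eq by (rule norm_sum)
  also have "\<dots> \<le> (\<Sum>j<L. H * E j)"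
  proof (intro sum_mono)
    fix j assume j: "j \<in> {..<L}"
    have "cmod (?T j * unit_exp (real j * (- of_int N / real L)) * ?D j) = cmod (?T j) * cmod (?D j)"
      by (simp only: norm_mult norm_unit_exp mult_1_right)
    also have "\<dots> \<le> cmod (?T j) * (H * min 2 (2 * pi * H * dist_int (real M * (real j / real L))))"
      by (intro mult_left_mono D) auto
    also have "\<dots> = H * (cmod (?T j) * min 2 (2 * pi * H * dist_int (real M * (real j / real L))))"
      by (simp only: mult.left_commute)
    also have "\<dots> \<le> H * E j"
      using E[of j] j by (intro mult_left_mono) (auto simp: prod_norm)
    finally show "cmod (?T j * unit_exp (real j * (- of_int N / real L)) * ?D j) \<le> H * E j" .
  qed
  finally show ?thesis by (simp only: sum_distrib_left)
qed

text \<open>The product is at most the k-th power of its largest factor. In place of Hoelder's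
  inequality this separates the coefficients at the cost of a constant.\<close>

lemma prod_le_sum_power:
  fixes f :: "nat \<Rightarrow> real"
  assumes "\<And>i. i < k \<Longrightarrow> 0 \<le> f i" "k > 0"
  shows "(\<Prod>i<k. f i) \<le> (\<Sum>i<k. f i ^ k)"
proof -
  define t where "t = Max (f ` {..<k})"
  have "t \<in> f ` {..<k}" unfolding t_def using assms(2) by (intro Max_in) auto
  then obtain i where i: "i < k" "t = f i" by auto
  have "(\<Prod>i<k. f i) \<le> (\<Prod>i<k. t)"
    using assms by (intro prod_mono) (auto simp: t_def)
  also have "\<dots> = f i ^ k" by (simp add: i)
  also have "\<dots> \<le> (\<Sum>i<k. f i ^ k)"
    using i assms by (intro member_le_sum) auto
  finally show ?thesis .
qed

text \<open>If some factor reaches \<eta> X, the frequency is near a fraction whose denominator a i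
  (m - 2) q divides M, so M times the frequency is close to an integer and the shift factor is
  small. Otherwise the shift factor is at most 2 and one of the ten factors is estimated by \<eta>
  X. Either way a ninth moment remains. C depends on neither \<eta> nor M, which lets both be chosen
  afterwards.\<close>

lemma rep_count_average_bound:
  assumes "m \<ge> 3" "\<And>i. i < 10 \<Longrightarrow> a i > 0"
  shows "\<exists>C::real. 0 < C \<and> (\<forall>\<eta> M H L X N. 0 < \<eta> \<longrightarrow> \<eta> \<le> 1 \<longrightarrow> 1024 \<le> \<eta> ^ 4 * real X \<longrightarrow> X\<^sup>2 \<le> L \<longrightarrow>
    0 \<le> N \<longrightarrow> N + int (M * H) < int L \<longrightarrow> H > 0 \<longrightarrow> M > 0 \<longrightarrow> rep_count m a 10 X N = 0 \<longrightarrow>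
    (\<forall>x\<in>box 10 X. 0 \<le> form_value m a 10 x \<and> form_value m a 10 x < int L) \<longrightarrow>
    (\<forall>i<10. \<forall>q::nat. 1 \<le> q \<longrightarrow> real q \<le> 16 / \<eta>\<^sup>2 \<longrightarrow> a i * (m - 2) * int q dvd int M) \<longrightarrow>
    real (\<Sum>h\<in>{1..H}. rep_count m a 10 X (N + int (M * h))) \<le>
      H * ((2 * \<eta> + 4096 * pi * H * M / (\<eta> ^ 6 * (real X)\<^sup>2)) * C * real X ^ 8))"
proof -
  have "\<forall>i<10. \<exists>C::real. 0 < C \<and> (\<forall>(X::nat) (L::nat). X \<ge> 1 \<longrightarrow> X\<^sup>2 \<le> L \<longrightarrow>
    (\<Sum>j<L. cmod (polygonal_sum m (a i) X (real j / real L)) ^ 9) \<le> C * real X ^ 7 * real L)"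
    using polygonal_sum_moment assms by blast
  then obtain Cf :: "nat \<Rightarrow> real" where Cf: "\<And>i. i < 10 \<Longrightarrow> 0 < Cf i"
    "\<And>i X L. i < 10 \<Longrightarrow> X \<ge> 1 \<Longrightarrow> X\<^sup>2 \<le> L \<Longrightarrow>
    (\<Sum>j<L. cmod (polygonal_sum m (a i) X (real j / real L)) ^ 9) \<le> Cf i * real X ^ 7 * real L"
    by metis
  define C where "C = (\<Sum>i<10. Cf i)"
  have C: "0 < C" unfolding C_def using Cf by (intro sum_pos) (auto simp: lessThan_empty_iff)
  have "real (\<Sum>h\<in>{1..H}. rep_count m a 10 X (N + int (M * h))) \<le>
      H * ((2 * \<eta> + 4096 * pi * H * M / (\<eta> ^ 6 * (real X)\<^sup>2)) * C * real X ^ 8)"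
    if \<eta>: "0 < \<eta>" "\<eta> \<le> 1" and \<eta>X: "1024 \<le> \<eta> ^ 4 * real X" and XL: "X\<^sup>2 \<le> L" and N: "0 \<le> N"
      and NL: "N + int (M * H) < int L" and H: "H > 0" and M: "M > 0" and rep: "rep_count m a 10 X N = 0"
      and range: "\<forall>x\<in>box 10 X. 0 \<le> form_value m a 10 x \<and> form_value m a 10 x < int L"
      and dvd: "\<forall>i<10. \<forall>q::nat. 1 \<le> q \<longrightarrow> real q \<le> 16 / \<eta>\<^sup>2 \<longrightarrow> a i * (m - 2) * int q dvd int M"
    for \<eta> M H L X N
  proof -
    let ?S = "\<lambda>i j. cmod (polygonal_sum m (a i) X (real j / real L))"
    let ?K = "4096 * pi * H * M / (\<eta> ^ 6 * (real X)\<^sup>2)"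
    let ?E = "\<lambda>j. (2 * \<eta> + ?K) * X * (\<Sum>i<10. ?S i j ^ 9)"
    have X: "X \<ge> 1" using \<eta>X by (cases X) auto
    have "0 \<le> int (M * H)" by simp
    with NL N have "0 < int L" by linarith
    then have L: "L > 0" by simp
    have K: "?K \<ge> 0" using \<eta> by auto
    have E: "(\<Prod>i<10. ?S i j) * min 2 (2 * pi * H * dist_int (real M * (real j / real L))) \<le> ?E j" for j
    proof (cases "\<exists>i<10. \<eta> * real X \<le> ?S i j")
      case True
      then obtain i where i: "i < 10" "\<eta> * real X \<le> ?S i j" by auto
      obtain q :: nat where q: "1 \<le> q" "real q \<le> 16 / \<eta>\<^sup>2"
        "dist_int (real j / real L * of_int (a i * (m - 2)) * real q) \<le> 2048 / (\<eta> ^ 6 * (real X)\<^sup>2)"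
        using weyl_inverse[OF \<eta> \<eta>X i(2)] by auto
      obtain t where t: "int M = a i * (m - 2) * int q * t" using dvd i q by (blast elim: dvdE)
      have b: "a i * (m - 2) * int q > 0" using assms i q by auto
      then have t0: "t > 0" using t M by (metis of_nat_0_less_iff zero_less_mult_pos)
      have "1 * t \<le> a i * (m - 2) * int q * t" using b t0 by (intro mult_right_mono) auto
      then have tM: "t \<le> int M" using t by simp
      have "real M = of_int (a i * (m - 2) * int q * t)"
        using t by (metis of_int_of_nat_eq)
      then have "real M * (real j / real L) = of_int t * (real j / real L * of_int (a i * (m - 2)) * real q)"
        by simp
      then have "dist_int (real M * (real j / real L)) \<le> \<bar>of_int t\<bar> * dist_int (real j / real L * of_int (a i * (m - 2)) * real q)"
        using dist_int_of_int_mult by metis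
      also have "\<dots> \<le> real M * (2048 / (\<eta> ^ 6 * (real X)\<^sup>2))"
      proof (rule mult_mono[OF _ q(3)])
        show "\<bar>real_of_int t\<bar> \<le> real M" using t0 tM by linarith
      qed (simp_all only: of_nat_0_le_iff dist_int_nonneg)
      finally have "2 * pi * H * dist_int (real M * (real j / real L)) \<le> 2 * pi * H * (real M * (2048 / (\<eta> ^ 6 * (real X)\<^sup>2)))"
        by (intro mult_left_mono) auto
      also have "\<dots> = ?K" by simp
      finally have "min 2 (2 * pi * H * dist_int (real M * (real j / real L))) \<le> ?K" by simp
      moreover have "(\<Prod>i<10. ?S i j) \<le> (\<Sum>i<10. ?S i j ^ 10)"
        by (rule prod_le_sum_power) auto
      moreover have "(\<Sum>i<10. ?S i j ^ 10) \<le> (\<Sum>i<10. X * ?S i j ^ 9)"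
      proof (intro sum_mono)
        fix i show "?S i j ^ 10 \<le> X * ?S i j ^ 9"
          using mult_right_mono[OF norm_polygonal_sum_le[of m "a i" X "real j / real L"], of "?S i j ^ 9"]
          by (simp add: eval_nat_numeral)
      qed
      ultimately have "(\<Prod>i<10. ?S i j) * min 2 (2 * pi * H * dist_int (real M * (real j / real L))) \<le>
        (\<Sum>i<10. X * ?S i j ^ 9) * ?K"
        using K dist_int_nonneg by (intro mult_mono) (auto intro!: sum_nonneg simp del: times_divide_eq_right)
      also have "\<dots> = ?K * X * (\<Sum>i<10. ?S i j ^ 9)"
        by (simp only: sum_distrib_left [symmetric] mult_ac)
      also have "\<dots> \<le> ?E j"
        using \<eta> by (intro mult_right_mono) (auto intro!: sum_nonneg)
      finally show ?thesis .
    next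
      case False
      then have small: "?S i j \<le> \<eta> * real X" if "i < 10" for i using that by auto
      have "(\<Prod>i<10. ?S i j) \<le> (\<Sum>i<10. ?S i j ^ 10)"
        by (rule prod_le_sum_power) auto
      also have "\<dots> \<le> (\<Sum>i<10. \<eta> * X * ?S i j ^ 9)"
      proof (intro sum_mono)
        fix i :: nat assume "i \<in> {..<10}"
        then show "?S i j ^ 10 \<le> \<eta> * X * ?S i j ^ 9"
          using mult_right_mono[OF small[of i], of "?S i j ^ 9"] by (simp add: eval_nat_numeral)
      qed
      finally have "(\<Prod>i<10. ?S i j) * min 2 (2 * pi * H * dist_int (real M * (real j / real L))) \<le>
        (\<Sum>i<10. \<eta> * X * ?S i j ^ 9) * 2"
        using \<eta> dist_int_nonneg by (intro mult_mono) (auto intro!: sum_nonneg)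
      also have "\<dots> = 2 * \<eta> * X * (\<Sum>i<10. ?S i j ^ 9)"
        by (simp only: sum_distrib_left [symmetric] mult_ac)
      also have "\<dots> \<le> ?E j"
        using K by (intro mult_right_mono) (auto intro!: sum_nonneg)
      finally show ?thesis .
    qed
    have "real L * real (\<Sum>h\<in>{1..H}. rep_count m a 10 X (N + int (M * h))) \<le> H * (\<Sum>j<L. ?E j)"
      using rep_count_average[OF N NL H rep _ E] range by simp
    also have "(\<Sum>j<L. ?E j) = (2 * \<eta> + ?K) * X * (\<Sum>j<L. \<Sum>i<10. ?S i j ^ 9)"
      by (simp only: sum_distrib_left)
    also have "(\<Sum>j<L. \<Sum>i<10. ?S i j ^ 9) = (\<Sum>i<10. \<Sum>j<L. ?S i j ^ 9)"
      by (rule sum.swap)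
    also have "H * ((2 * \<eta> + ?K) * X * (\<Sum>i<10. \<Sum>j<L. ?S i j ^ 9)) \<le>
      H * ((2 * \<eta> + ?K) * X * (\<Sum>i<10. Cf i * real X ^ 7 * real L))"
      using Cf(2) X XL K \<eta> by (intro mult_left_mono sum_mono) auto
    also have "(\<Sum>i<10. Cf i * real X ^ 7 * real L) = C * real X ^ 7 * real L"
      unfolding C_def by (simp only: sum_distrib_right)
    also have "H * ((2 * \<eta> + ?K) * X * (C * real X ^ 7 * real L)) =
      real L * (H * ((2 * \<eta> + ?K) * C * real X ^ 8))"
      by (simp only: power_Suc [of "real X" 7, simplified] mult_ac)
    finally show ?thesis
      using L by (simp only: mult_le_cancel_left_pos of_nat_0_less_iff)
  qed
  then show ?thesis
    using C by (intro exI[of _ C]) blast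
qed

section \<open>Lower bound for the number of representations in a window\<close>

lemma polygonal_dvd_diff:
  assumes "2 * M dvd x - y"
  shows "M dvd polygonal m x - polygonal m y"
proof -
  obtain t where t: "x - y = 2 * M * t" using assms by blast
  have "polygonal m x = polygonal m (2 * M * t) + polygonal m y + (m - 2) * (2 * M * t) * y"
    using polygonal_add[of m "2 * M * t" y] t by (simp add: diff_eq_eq)
  \<comment> \<open>The division by 2 in \<open>polygonal\<close> uses up the factor 2 of the
    modulus 2 M; congruence modulo M alone would not do.\<close>
  moreover have "polygonal m (2 * M * t) = M * ((m - 2) * 2 * M * t\<^sup>2 - (m - 4) * t)"
    using two_times_polygonal[of m "2 * M * t"] by (simp add: algebra_simps power2_eq_square)
  ultimately have "polygonal m x - polygonal m y =
      M * ((m - 2) * 2 * M * t\<^sup>2 - (m - 4) * t) + M * ((m - 2) * (2 * t) * y)"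
    by simp
  then show ?thesis by (metis dvd_add dvd_triv_left)
qed

lemma form_value_dvd_diff:
  assumes "\<And>i. i < k \<Longrightarrow> 2 * M dvd x i - y i"
  shows "M dvd form_value m a k x - form_value m a k y"
proof -
  have "form_value m a k x - form_value m a k y = (\<Sum>i<k. a i * (polygonal m (x i) - polygonal m (y i)))"
    unfolding form_value_def by (simp add: sum_subtractf right_diff_distrib)
  then show ?thesis
    using polygonal_dvd_diff assms by (auto intro!: dvd_sum)
qed

lemma form_value_nonneg:
  assumes "m \<ge> 3" "\<And>i. i < k \<Longrightarrow> a i > 0"
  shows "0 \<le> form_value m a k x"
  unfolding form_value_def using assms
  by (intro sum_nonneg mult_nonneg_nonneg polygonal_nonneg) (auto intro: less_imp_le)

text \<open>Used to place the distinguished variable right after the point where the form passes N.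
  From 3 s on the values exceed T because P(v) >= v^2 / 2 >= 9 s^2 / 2 > 4 s^2.\<close>

lemma greatest_polygonal_below:
  assumes "m \<ge> 3" "c > 0" "0 \<le> T" "T < 4 * s\<^sup>2" "0 < s"
  shows "\<exists>u. 0 \<le> u \<and> u < 3 * s \<and> c * polygonal m u \<le> T \<and> (\<forall>v>u. T < c * polygonal m v)"
proof -
  define F where "F = {u\<in>{0..<3 * s}. c * polygonal m u \<le> T}"
  have "F \<subseteq> {0..<3 * s}" unfolding F_def by auto
  then have F: "finite F" "0 \<in> F" unfolding F_def using assms finite_subset by auto
  define u where "u = Max F"
  have u: "u \<in> F" "\<And>v. v \<in> F \<Longrightarrow> v \<le> u" 
    unfolding u_def using F by (auto intro!: Max_in Max_ge)
  have "T < c * polygonal m v" if v: "v > u" for v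
  proof (cases "v < 3 * s")
    case True
    then have "v \<in> F \<or> T < c * polygonal m v" using v u unfolding F_def by auto
    then show ?thesis using u(2)[of v] v by auto
  next
    case False
    then have "(3 * s)\<^sup>2 \<le> v\<^sup>2" using assms by (intro power_mono) auto
    also have "\<dots> \<le> 2 * polygonal m v" using False assms by (intro polygonal_lower) auto
    finally have "T < polygonal m v" using assms by (simp add: power2_eq_square)
    also have "1 * polygonal m v \<le> c * polygonal m v"
      using assms by (intro mult_right_mono polygonal_nonneg) auto
    finally show ?thesis by simp
  qed
  then show ?thesis using u unfolding F_def by auto
qed

lemma div_mod_eqD:
  fixes q :: int
  assumes "r + q * l = r' + q * l'" "0 \<le> r" "r < q" "0 \<le> r'" "r' < q"
  shows "r = r' \<and> l = l'"
proof -
  have "(r + q * l) mod q = r" "(r' + q * l') mod q = r'"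
    using assms(2-5) by (simp_all only: mod_mult_self2 mod_pos_pos_trivial)
  then have "r = r'" using assms(1) by simp
  then show ?thesis using assms by auto
qed

text \<open>Representations of numbers slightly above N are built by hand. All variables but
  \<open>x 0\<close> run freely below 2 M Z, so small that their total stays at most N;
  \<open>x 0\<close> takes one of g values just above the point where the form passes N, in the
  class modulo 2 M that makes the value congruent to N modulo M. The left-hand side counts the free
  choices.\<close>

lemma window_count:
  fixes s M Z g H X :: nat
  assumes m: "m \<ge> 3" and a: "\<And>i. i < k \<Longrightarrow> a i > 0" and k: "k > 0" and M: "M > 0"
    and N: "(m - 2) * (\<Sum>i<k. a i) * (int (2 * M * Z))\<^sup>2 \<le> N" "N < 4 * (int s)\<^sup>2"
    and ZX: "2 * M * Z \<le> X" and g: "2 * M * g \<le> s" and sX: "4 * s \<le> X" and s: "s > 0"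
    and H: "int H = 8 * (a 0 * (m - 2)) * int s * int g"
  shows "card {\<xi>\<in>box k (2 * M). int M dvd form_value m a k \<xi> - N} * Z ^ (k - 1) * g \<le>
    (\<Sum>h\<in>{1..H}. rep_count m a k X (N + int (M * h)))"
proof -
  let ?\<Xi> = "{\<xi>\<in>box k (2 * M). int M dvd form_value m a k \<xi> - N}"
  let ?D = "?\<Xi> \<times> PiE {1..<k} (\<lambda>_. {0..<int Z}) \<times> {0..<int g}"
  let ?V = "\<Union>h\<in>{1..H}. {x\<in>box k X. form_value m a k x = N + int (M * h)}"
  define q where "q = 2 * int M"
  have q: "q > 0" unfolding q_def using M by simp
  define rest where "rest = (\<lambda>x. \<Sum>i\<in>{1..<k}. a i * polygonal m (x i))"
  have form: "form_value m a k x = a 0 * polygonal m (x 0) + rest x" for x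
  proof -
    have "{..<k} = insert 0 {1..<k}" using k by auto
    then show ?thesis unfolding form_value_def rest_def by simp
  qed
  have "\<forall>T. 0 \<le> T \<and> T < 4 * (int s)\<^sup>2 \<longrightarrow>
      (\<exists>u. 0 \<le> u \<and> u < 3 * int s \<and> a 0 * polygonal m u \<le> T \<and> (\<forall>v>u. T < a 0 * polygonal m v))"
    using greatest_polygonal_below m a k s by simp
  then obtain U where U: "\<And>T. 0 \<le> T \<Longrightarrow> T < 4 * (int s)\<^sup>2 \<Longrightarrow> 0 \<le> U T \<and> U T < 3 * int s \<and>
      a 0 * polygonal m (U T) \<le> T \<and> (\<forall>v>U T. T < a 0 * polygonal m v)"
    by metis
  define y where "y = (\<lambda>(\<xi>::nat \<Rightarrow> int) z i. \<xi> i + q * z i)"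
  define u where "u = (\<lambda>\<xi> z. U (N - rest (y \<xi> z)))"
  \<comment> \<open>\<open>u \<xi> z + 1 + (\<xi> 0 - u \<xi> z - 1) mod q\<close> is the least
    integer above \<open>u \<xi> z\<close> congruent to \<open>\<xi> 0\<close> modulo q; adding q l
    with l < g lists g successive ones.\<close>
  define \<phi> where "\<phi> = (\<lambda>(\<xi>, z, l). \<lambda>i\<in>{..<k}. if i = 0
    then u \<xi> z + 1 + (\<xi> 0 - u \<xi> z - 1) mod q + q * l else y \<xi> z i)"
  have y_range: "0 \<le> y \<xi> z i \<and> y \<xi> z i < int (2 * M * Z)"
    if "\<xi> \<in> box k (2 * M)" "z \<in> PiE {1..<k} (\<lambda>_. {0..<int Z})" "i \<in> {1..<k}" for \<xi> z i
  proof -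
    have \<xi>: "0 \<le> \<xi> i" "\<xi> i < q" using that unfolding box_def q_def by (auto dest: PiE_mem)
    have z: "0 \<le> z i" "z i \<le> int Z - 1" using that by (auto dest: PiE_mem)
    have "q * z i \<le> q * (int Z - 1)" using z q by (intro mult_left_mono) auto
    then have "y \<xi> z i < q * int Z" using \<xi> unfolding y_def by (simp add: algebra_simps)
    moreover have "0 \<le> y \<xi> z i" unfolding y_def using \<xi> z q by simp
    ultimately show ?thesis unfolding q_def by simp
  qed
  have T: "0 \<le> N - rest (y \<xi> z) \<and> N - rest (y \<xi> z) < 4 * (int s)\<^sup>2"
    if "\<xi> \<in> box k (2 * M)" "z \<in> PiE {1..<k} (\<lambda>_. {0..<int Z})" for \<xi> z
  proof -
    have "rest (y \<xi> z) \<le> (\<Sum>i\<in>{1..<k}. a i * ((m - 2) * (int (2 * M * Z))\<^sup>2))"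
      unfolding rest_def
    proof (intro sum_mono mult_left_mono)
      fix i assume i: "i \<in> {1..<k}"
      have "polygonal m (y \<xi> z i) \<le> (m - 2) * (y \<xi> z i)\<^sup>2"
        using y_range[OF that i] m by (intro polygonal_upper) auto
      also have "\<dots> \<le> (m - 2) * (int (2 * M * Z))\<^sup>2"
        using y_range[OF that i] m by (intro mult_left_mono power_mono) auto
      finally show "polygonal m (y \<xi> z i) \<le> (m - 2) * (int (2 * M * Z))\<^sup>2" .
    qed (use a in \<open>auto intro: less_imp_le\<close>)
    also have "\<dots> \<le> (\<Sum>i<k. a i * ((m - 2) * (int (2 * M * Z))\<^sup>2))"
      using a m by (intro sum_mono2) (auto intro!: mult_nonneg_nonneg less_imp_le[of 0 "a _"])
    also have "\<dots> \<le> N"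
      using N by (simp add: sum_distrib_right mult_ac)
    finally have "rest (y \<xi> z) \<le> N" .
    moreover have "0 \<le> rest (y \<xi> z)"
      unfolding rest_def using a m
      by (intro sum_nonneg mult_nonneg_nonneg polygonal_nonneg) (auto intro: less_imp_le)
    ultimately show ?thesis using N by linarith
  qed
  \<comment> \<open>The coordinates i >= 1 give back \<open>\<xi> i\<close> and \<open>z i\<close>
    by division with remainder. These determine u, after which coordinate 0 gives back l and the
    class of \<open>\<xi> 0\<close> modulo q.\<close>
  have "inj_on \<phi> ?D"
  proof (rule inj_onI, clarify, goal_cases)
    case (1 \<xi> z l \<xi>' z' l')
    have eq: "\<phi> (\<xi>, z, l) i = \<phi> (\<xi>', z', l') i" for i using 1 by simp
    have \<xi>: "0 \<le> \<xi> i" "\<xi> i < q" "0 \<le> \<xi>' i" "\<xi>' i < q" if "i < k" for i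
      using 1 that unfolding box_def q_def by (auto dest: PiE_mem)
    have yz: "\<xi> i = \<xi>' i \<and> z i = z' i" if i: "i \<in> {1..<k}" for i
    proof (rule div_mod_eqD)
      show "\<xi> i + q * z i = \<xi>' i + q * z' i"
        using eq[of i] i unfolding \<phi>_def y_def by simp
    qed (use i \<xi> in auto)
    then have "rest (y \<xi> z) = rest (y \<xi>' z')"
      unfolding rest_def y_def by simp
    then have uu: "u \<xi> z = u \<xi>' z'" unfolding u_def by simp
    have "(\<xi> 0 - u \<xi> z - 1) mod q = (\<xi>' 0 - u \<xi> z - 1) mod q \<and> l = l'"
    proof (rule div_mod_eqD)
      show "(\<xi> 0 - u \<xi> z - 1) mod q + q * l = (\<xi>' 0 - u \<xi> z - 1) mod q + q * l'"
        using eq[of 0] k uu unfolding \<phi>_def by simp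
    qed (use q in auto)
    moreover from this have "q dvd (\<xi> 0 - u \<xi> z - 1) - (\<xi>' 0 - u \<xi> z - 1)"
      by (simp only: mod_eq_dvd_iff)
    then have "\<xi> 0 mod q = \<xi>' 0 mod q" by (simp add: mod_eq_dvd_iff)
    then have "\<xi> 0 = \<xi>' 0" using \<xi>[OF k] by simp
    ultimately have "\<xi> i = \<xi>' i" if "i < k" for i
      using yz[of i] that by (cases "i = 0") auto
    then have "\<xi> = \<xi>'" using 1 unfolding box_def by (intro PiE_ext[of \<xi> "{..<k}"]) auto
    moreover have "z = z'" using 1 yz by (intro PiE_ext[of z "{1..<k}"]) auto
    moreover note \<open>_ \<and> l = l'\<close>
    ultimately show ?case by simp
  qed
  moreover have "\<phi> ` ?D \<subseteq> ?V"
  proof clarify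
    fix \<xi> z l assume \<xi>: "\<xi> \<in> box k (2 * M)" "int M dvd form_value m a k \<xi> - N"
      and z: "z \<in> PiE {1..<k} (\<lambda>_. {0..<int Z})" and l: "l \<in> {0..<int g}"
    let ?x = "\<phi> (\<xi>, z, l)" and ?u = "u \<xi> z"
    note T = T[OF \<xi>(1) z]
    have u: "0 \<le> ?u" "?u < 3 * int s" "a 0 * polygonal m ?u \<le> N - rest (y \<xi> z)"
      "\<And>v. v > ?u \<Longrightarrow> N - rest (y \<xi> z) < a 0 * polygonal m v"
      using U T unfolding u_def by auto
    have x0: "?x 0 = ?u + 1 + (\<xi> 0 - ?u - 1) mod q + q * l" unfolding \<phi>_def using k by simp
    have xi: "?x i = y \<xi> z i" if "i \<in> {1..<k}" for i using that unfolding \<phi>_def by simp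
    then have rest: "rest ?x = rest (y \<xi> z)" unfolding rest_def by simp
    define t where "t = ?x 0 - ?u"
    have r: "0 \<le> (\<xi> 0 - ?u - 1) mod q" "(\<xi> 0 - ?u - 1) mod q < q" using q by auto
    have "q * l \<le> q * (int g - 1)" "0 \<le> q * l" using l q by auto
    then have t: "0 < t" "t \<le> q * int g"
      using r unfolding t_def x0 by (simp_all add: algebra_simps)
    have "int (2 * M * g) \<le> int s" using g by (rule of_nat_mono)
    then have qg: "q * int g \<le> int s" unfolding q_def by simp
    have "?x \<in> box k X"
    proof -
      have "?x i \<in> {0..<int X}" if "i < k" for i
      proof (cases "i = 0")
        case True
        have "int (4 * s) \<le> int X" using sX by (rule of_nat_mono)
        then show ?thesis using True t u qg unfolding t_def by auto
      next
        case False
        then have "i \<in> {1..<k}" using that by auto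
        moreover have "int (2 * M * Z) \<le> int X" using ZX by (rule of_nat_mono)
        ultimately show ?thesis using y_range[OF \<xi>(1) z, of i] xi by auto
      qed
      then show ?thesis unfolding box_def \<phi>_def by auto
    qed
    moreover have "\<exists>h\<in>{1..H}. form_value m a k ?x = N + int (M * h)"
    proof -
      have "2 * int M dvd ?x i - \<xi> i" if "i < k" for i
      proof (cases "i = 0")
        case True
        have "?x 0 - \<xi> 0 = q * l - ((\<xi> 0 - ?u - 1) - (\<xi> 0 - ?u - 1) mod q)"
          unfolding x0 by simp
        then have "?x 0 - \<xi> 0 = q * l - q * ((\<xi> 0 - ?u - 1) div q)"
          by (simp only: minus_mod_eq_mult_div)
        then show ?thesis using True unfolding q_def by (metis dvd_diff dvd_triv_left)
      next
        case False
        then have "?x i - \<xi> i = q * z i" using xi[of i] that unfolding y_def by simp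
        then show ?thesis unfolding q_def by simp
      qed
      then have "int M dvd form_value m a k ?x - form_value m a k \<xi>"
        by (rule form_value_dvd_diff)
      then have "int M dvd form_value m a k ?x - N"
        using \<xi>(2) by (metis diff_add_cancel dvd_add add_diff_eq)
      then obtain h where h: "form_value m a k ?x - N = int M * h" by blast
      have "N - rest (y \<xi> z) < a 0 * polygonal m (?x 0)"
        using t u(4)[of "?x 0"] unfolding t_def by simp
      then have "0 < int M * h" using h form[of ?x] rest by simp
      then have h0: "0 < h" using M by (simp add: zero_less_mult_iff)
      have "polygonal m (?x 0) - polygonal m ?u = polygonal m t + (m - 2) * t * ?u"
        using polygonal_add[of m t ?u] unfolding t_def by simp
      also have "\<dots> \<le> (m - 2) * t\<^sup>2 + (m - 2) * t * ?u"
        using m t by (intro add_right_mono polygonal_upper) auto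
      also have "\<dots> = (m - 2) * (t * (t + ?u))" by (simp add: power2_eq_square algebra_simps)
      \<comment> \<open>Here t <= 2 M g <= s and u < 3 s, so t + u <= 4 s. This fixes H: the
        overshoot a 0 (m - 2) * 2 M g * 4 s equals M H.\<close>
      also have "\<dots> \<le> (m - 2) * ((q * int g) * (4 * int s))"
        using m t u qg by (intro mult_left_mono mult_mono) auto
      finally have "a 0 * (polygonal m (?x 0) - polygonal m ?u) \<le> a 0 * ((m - 2) * ((q * int g) * (4 * int s)))"
        using a[of 0] k by (intro mult_left_mono) auto
      also have "\<dots> = int M * int H" unfolding H q_def by simp
      finally have "int M * h \<le> int M * int H"
        using h form[of ?x] rest u(3) by (simp add: right_diff_distrib)
      then have "h \<le> int H" using M by simp
      then show ?thesis using h h0 by (intro bexI[of _ "nat h"]) auto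
    qed
    ultimately show "?x \<in> ?V" by blast
  qed
  moreover have "finite ?V" by auto
  ultimately have "card ?D \<le> card ?V" by (rule card_inj_on_le)
  also have "\<dots> \<le> (\<Sum>h\<in>{1..H}. rep_count m a k X (N + int (M * h)))"
    unfolding rep_count_def by (rule card_UN_le) simp
  finally have "card ?D \<le> (\<Sum>h\<in>{1..H}. rep_count m a k X (N + int (M * h)))" .
  moreover have "card ?D = card ?\<Xi> * Z ^ (k - 1) * g"
    unfolding card_cartesian_product by (simp add: card_PiE)
  ultimately show ?thesis by (simp only:)
qed

text \<open>Pigeonhole stands in for a positive singular series: some class receives at least the
  average share of the box, but which one is not known.\<close>

lemma popular_residue:
  assumes "M > 0"
  shows "\<exists>N0. (2 * M) ^ k \<le> card {\<xi>\<in>box k (2 * M). int M dvd form_value m a k \<xi> - N0} * M"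
proof -
  have card: "card (box k (2 * M)) = (2 * M) ^ k"
    unfolding box_def by (simp add: card_PiE nat_mult_distrib)
  have "\<exists>y\<in>{0..<int M}. card (box k (2 * M)) \<le>
      card ((\<lambda>\<xi>. form_value m a k \<xi> mod int M) -` {y} \<inter> box k (2 * M)) * card {0..<int M}"
    using assms by (intro pigeonhole_card) auto
  then obtain N0 where "N0 \<in> {0..<int M}" and *: "(2 * M) ^ k \<le>
      card ((\<lambda>\<xi>. form_value m a k \<xi> mod int M) -` {N0} \<inter> box k (2 * M)) * M"
    unfolding card by auto
  then have "N0 mod int M = N0" by simp
  then have "(\<lambda>\<xi>. form_value m a k \<xi> mod int M) -` {N0} \<inter> box k (2 * M) =
      {\<xi>\<in>box k (2 * M). int M dvd form_value m a k \<xi> - N0}"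
    by (auto simp flip: mod_eq_dvd_iff)
  then show ?thesis using * by auto
qed

text \<open>If some N with s^2 <= N < (s + 1)^2 were not represented, \<open>window_count\<close>
  and \<open>rep_count_average_bound\<close> would bound the same sum from below by c0 H s^8 and
  from above by half of that. The choice of constants is not circular: c0 and C do not involve M,
  they determine \<eta>, then \<eta> determines M, and M enters only into \<kappa>.\<close>

theorem represents_progression:
  assumes m: "m \<ge> 3" and a: "\<And>i. i < 10 \<Longrightarrow> a i > 0"
  shows "\<exists>M::nat>0. \<exists>N0 B. \<forall>N\<ge>B. int M dvd N - N0 \<longrightarrow> (\<exists>x. form_value m a 10 x = N)"
proof -
  obtain C :: real where C: "0 < C" and avg: "\<And>\<eta> M H L X N. 0 < \<eta> \<Longrightarrow> \<eta> \<le> 1 \<Longrightarrow>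
    1024 \<le> \<eta> ^ 4 * real X \<Longrightarrow> X\<^sup>2 \<le> L \<Longrightarrow>
    0 \<le> N \<Longrightarrow> N + int (M * H) < int L \<Longrightarrow> H > 0 \<Longrightarrow> M > 0 \<Longrightarrow> rep_count m a 10 X N = 0 \<Longrightarrow>
    (\<forall>x\<in>box 10 X. 0 \<le> form_value m a 10 x \<and> form_value m a 10 x < int L) \<Longrightarrow>
    (\<forall>i<10. \<forall>q::nat. 1 \<le> q \<longrightarrow> real q \<le> 16 / \<eta>\<^sup>2 \<longrightarrow> a i * (m - 2) * int q dvd int M) \<Longrightarrow>
    real (\<Sum>h\<in>{1..H}. rep_count m a 10 X (N + int (M * h))) \<le>
      H * ((2 * \<eta> + 4096 * pi * H * M / (\<eta> ^ 6 * (real X)\<^sup>2)) * C * real X ^ 8)"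
    using rep_count_average_bound[of m a, OF m a] by blast
  define A where "A = nat (a 0 * (m - 2))"
  define G where "G = nat ((m - 2) * (\<Sum>i<10. a i))"
  have A: "A > 0" "int A = a 0 * (m - 2)" unfolding A_def using m a[of 0] by auto
  have "(\<Sum>i<10. a i) > 0" using a by (intro sum_pos) (auto simp: lessThan_empty_iff)
  then have G: "G > 0" "int G = (m - 2) * (\<Sum>i<10. a i)" unfolding G_def using m by auto
  \<comment> \<open>M cancels in the lower bound: the popular class has at least (2 M)^10 / M = 1024
    M^9 points, nine variables have Z >= s / (4 M G) choices each, and g = H / (8 A s).\<close>
  define c0 :: real where "c0 = 1024 / ((4 * real G) ^ 9 * (8 * real A))"
  have c0: "c0 > 0" unfolding c0_def using A G by simp
  \<comment> \<open>390625 = 5^8 comes from X = 5 s. With this \<eta> the frequencies with small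
    sums account for at most a quarter of c0.\<close>
  define \<eta> where "\<eta> = min 1 (c0 / (8 * C * 390625))"
  have \<eta>: "0 < \<eta>" "\<eta> \<le> 1" "\<eta> \<le> c0 / (8 * C * 390625)" unfolding \<eta>_def using c0 C by auto
  define M where "M = nat ((\<Prod>i<10. a i) * (m - 2)) * fact (nat \<lfloor>16 / \<eta>\<^sup>2\<rfloor>)"
  have aprod: "(\<Prod>i<10. a i) * (m - 2) > 0" using a m by (auto intro!: mult_pos_pos prod_pos)
  then have M: "M > 0" unfolding M_def by simp
  have dvdM: "\<forall>i<10. \<forall>q::nat. 1 \<le> q \<longrightarrow> real q \<le> 16 / \<eta>\<^sup>2 \<longrightarrow> a i * (m - 2) * int q dvd int M"
  proof (intro allI impI)
    fix i q :: nat assume i: "i < 10" and q: "1 \<le> q" "real q \<le> 16 / \<eta>\<^sup>2"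
    have "q \<le> nat \<lfloor>16 / \<eta>\<^sup>2\<rfloor>" using q by (simp add: le_nat_floor)
    then have "q dvd fact (nat \<lfloor>16 / \<eta>\<^sup>2\<rfloor>)" using q by (intro dvd_fact) auto
    then have "int q dvd int (fact (nat \<lfloor>16 / \<eta>\<^sup>2\<rfloor>))" by (simp only: of_nat_dvd_iff)
    moreover have "a i dvd (\<Prod>i<10. a i)" using i by (intro dvd_prodI) auto
    ultimately have "a i * (m - 2) * int q dvd (\<Prod>i<10. a i) * (m - 2) * int (fact (nat \<lfloor>16 / \<eta>\<^sup>2\<rfloor>))"
      by (intro mult_dvd_mono) auto
    also have "\<dots> = int M" unfolding M_def using aprod by simp
    finally show "a i * (m - 2) * int q dvd int M" .
  qed
  \<comment> \<open>With g = floor(\<kappa> s) the window M H has order s^2. The first bound gives 2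
    M g <= s; the second makes the frequencies near fractions account for at most another quarter of
    c0.\<close>
  define \<kappa> where "\<kappa> = min (1 / (2 * real M)) (c0 * 25 * \<eta> ^ 6 / (4 * 4096 * pi * 8 * real A * real M * C * 390625))"
  have \<kappa>: "\<kappa> > 0" "\<kappa> \<le> 1 / (2 * real M)"
    "\<kappa> \<le> c0 * 25 * \<eta> ^ 6 / (4 * 4096 * pi * 8 * real A * real M * C * 390625)"
    unfolding \<kappa>_def using M c0 \<eta> A C by auto
  obtain N0 where N0: "(2 * M) ^ 10 \<le> card {\<xi>\<in>box 10 (2 * M). int M dvd form_value m a 10 \<xi> - N0} * M"
    using popular_residue[OF M] by blast
  \<comment> \<open>The three summands ensure g >= 1, Z >= s / (4 M G) and 1024 <= \<eta>^4
    X.\<close>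
  define s0 where "s0 = nat \<lceil>1 / \<kappa>\<rceil> + 4 * M * G + nat \<lceil>1024 / \<eta> ^ 4\<rceil>"
  have main: "rep_count m a 10 (5 * s) N \<noteq> 0"
    if s: "s0 \<le> s" and Ns: "(int s)\<^sup>2 \<le> N" "N < (int s + 1)\<^sup>2" and cong: "int M dvd N - N0" for s N
  proof
    assume rep: "rep_count m a 10 (5 * s) N = 0"
    define g where "g = nat \<lfloor>\<kappa> * s\<rfloor>"
    define Z where "Z = s div (2 * M * G)"
    define H where "H = 8 * A * s * g"
    \<comment> \<open>Larger than N + M H and than all values on the box, so that the discrete
      transform counts exactly, and at least X^2 for the moment bound.\<close>
    define L where "L = nat (N + int (M * H) + int G * (int (5 * s))\<^sup>2 + 1)"
    have "1 / \<kappa> \<le> s" "4 * M * G \<le> s" and s3: "1024 / \<eta> ^ 4 \<le> s"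
      using s unfolding s0_def by linarith+
    then have "1 \<le> \<kappa> * s" using \<kappa> by (simp add: field_simps)
    then have g: "0 < g" "real g \<le> \<kappa> * s" unfolding g_def by (simp_all add: zero_less_nat_eq)
    have s1: "s \<ge> 1" using \<open>4 * M * G \<le> s\<close> M G by (cases s) auto
    have sq: "(int s + 1)\<^sup>2 \<le> 4 * (int s)\<^sup>2"
    proof -
      have "(int s + 1)\<^sup>2 \<le> (2 * int s)\<^sup>2" using s1 by (intro power_mono) auto
      then show ?thesis by (simp add: power2_eq_square)
    qed
    have "real g \<le> real s / (2 * real M)"
      using g(2) mult_right_mono[OF \<kappa>(2), of "real s"] by simp
    then have "real (2 * M * g) \<le> real s" using M by (simp add: field_simps)
    then have gs: "2 * M * g \<le> s" by (simp only: of_nat_le_iff)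
    have GZ: "2 * M * Z * G \<le> s" unfolding Z_def using div_times_less_eq_dividend[of s "2 * M * G"]
      by (simp only: mult_ac)
    have H: "H > 0" unfolding H_def using A s1 g by simp
    have NZ: "(m - 2) * (\<Sum>i<10. a i) * (int (2 * M * Z))\<^sup>2 \<le> N"
    proof -
      have "int G * (int (2 * M * Z))\<^sup>2 \<le> int G * (int G * (int (2 * M * Z))\<^sup>2)"
        using G(1) mult_right_mono[of 1 "int G" "int G * (int (2 * M * Z))\<^sup>2"] by simp
      also have "\<dots> = (int (2 * M * Z * G))\<^sup>2" by (simp add: power2_eq_square)
      also have "\<dots> \<le> (int s)\<^sup>2" using GZ by (intro power_mono) (simp_all only: of_nat_mono of_nat_0_le_iff)
      finally show ?thesis using Ns G(2) by simp
    qed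
    have "card {\<xi>\<in>box 10 (2 * M). int M dvd form_value m a 10 \<xi> - N} * Z ^ (10 - 1) * g \<le>
      (\<Sum>h\<in>{1..H}. rep_count m a 10 (5 * s) (N + int (M * h)))"
    proof (rule window_count)
      have "2 * M * Z * 1 \<le> 2 * M * Z * G" using G by (intro mult_left_mono) auto
      with GZ have "2 * M * Z * 1 \<le> s" by (rule order_trans[rotated])
      then show "2 * M * Z \<le> 5 * s" by simp
      show "int H = 8 * (a 0 * (m - 2)) * int s * int g"
        unfolding H_def by (simp add: A)
      show "N < 4 * (int s)\<^sup>2" using Ns sq by linarith
    qed (use m a M NZ gs s1 in auto)
    also have "{\<xi>\<in>box 10 (2 * M). int M dvd form_value m a 10 \<xi> - N} = {\<xi>\<in>box 10 (2 * M). int M dvd form_value m a 10 \<xi> - N0}"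
    proof -
      have "int M dvd f - N \<longleftrightarrow> int M dvd f - N0" for f
        using cong dvd_diff[of "int M" "f - N0" "N - N0"] dvd_add[of "int M" "f - N" "N - N0"] by auto
      then show ?thesis by simp
    qed
    finally have count: "card {\<xi>\<in>box 10 (2 * M). int M dvd form_value m a 10 \<xi> - N0} * Z ^ 9 * g \<le>
      (\<Sum>h\<in>{1..H}. rep_count m a 10 (5 * s) (N + int (M * h)))" by simp
    let ?R = "real (\<Sum>h\<in>{1..H}. rep_count m a 10 (5 * s) (N + int (M * h)))"
    have lower: "H * (c0 * real s ^ 8) \<le> ?R"
    proof -
      let ?c = "card {\<xi>\<in>box 10 (2 * M). int M dvd form_value m a 10 \<xi> - N0}"
      have "real ((2 * M) ^ 10) \<le> real (?c * M)" using N0 by (rule of_nat_mono)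
      then have "real M * (1024 * real M ^ 9) \<le> real M * real ?c"
        by (simp add: power_mult_distrib eval_nat_numeral mult_ac)
      then have c: "1024 * real M ^ 9 \<le> real ?c" using M by (simp only: mult_le_cancel_left_pos of_nat_0_less_iff)
      have "real s / (4 * M * G) \<le> real Z"
      proof -
        have "real s / (2 * M * G) - 1 \<le> real Z"
          using floor_divide_of_nat_eq[of s "2 * M * G", where ?'a = real] unfolding Z_def by linarith
        moreover have "1 \<le> real s / (4 * M * G)"
        proof -
          have "real (4 * M * G) \<le> real s" using \<open>4 * M * G \<le> s\<close> by (rule of_nat_mono)
          then show ?thesis using M G by simp
        qed
        moreover have "real s / (2 * M * G) = 2 * (real s / (4 * M * G))" by simp
        ultimately show ?thesis by linarith
      qed
      then have Z: "(real s / (4 * M * G)) ^ 9 \<le> real Z ^ 9" by (intro power_mono) auto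
      have "H * (c0 * real s ^ 8) = 1024 * real M ^ 9 * (real s / (4 * M * G)) ^ 9 * g"
        unfolding H_def c0_def using A G M by (simp add: power_mult_distrib power_divide field_simps eval_nat_numeral)
      also have "\<dots> \<le> real ?c * real Z ^ 9 * g"
        using c Z by (intro mult_mono) auto
      also have "\<dots> = real (?c * Z ^ 9 * g)" by simp
      also have "\<dots> \<le> ?R" using count by (rule of_nat_mono)
      finally show ?thesis .
    qed
    have upper: "?R \<le> H * ((2 * \<eta> + 4096 * pi * H * M / (\<eta> ^ 6 * (real (5 * s))\<^sup>2)) * C * real (5 * s) ^ 8)"
    proof (rule avg[where L = L])
      have N0': "0 \<le> N" using Ns(1) order_trans[OF zero_le_power2[of "int s"]] by simp
      then show "0 \<le> N" .
      have intL: "int L = N + int (M * H) + int G * (int (5 * s))\<^sup>2 + 1"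
        unfolding L_def using N0' by simp
      then show "N + int (M * H) < int L"
        using mult_nonneg_nonneg[of "int G" "(int (5 * s))\<^sup>2"] by simp
      have "(int (5 * s))\<^sup>2 \<le> int G * (int (5 * s))\<^sup>2"
        using G(1) mult_right_mono[of 1 "int G" "(int (5 * s))\<^sup>2"] by simp
      then have "(int (5 * s))\<^sup>2 \<le> int L"
        using intL N0' of_nat_0_le_iff[of "M * H"] by linarith
      then show "(5 * s)\<^sup>2 \<le> L" by (simp only: of_nat_power [symmetric] of_nat_le_iff)
      show "1024 \<le> \<eta> ^ 4 * real (5 * s)"
        using s3 \<eta> by (simp add: field_simps)
      show "\<forall>x\<in>box 10 (5 * s). 0 \<le> form_value m a 10 x \<and> form_value m a 10 x < int L"
      proof (intro ballI conjI)
        fix x assume x: "x \<in> box 10 (5 * s)"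
        show "0 \<le> form_value m a 10 x" using form_value_nonneg m a by blast
        have "form_value m a 10 x \<le> (\<Sum>i<10. a i * ((m - 2) * (int (5 * s))\<^sup>2))"
          unfolding form_value_def
        proof (intro sum_mono mult_left_mono)
          fix i :: nat assume i: "i \<in> {..<10}"
          then have xi: "0 \<le> x i" "x i \<le> int (5 * s)" using x unfolding box_def by (force dest: PiE_mem)+
          then have "polygonal m (x i) \<le> (m - 2) * (x i)\<^sup>2" using m by (intro polygonal_upper) auto
          also have "\<dots> \<le> (m - 2) * (int (5 * s))\<^sup>2"
            using m xi by (intro mult_left_mono power_mono) auto
          finally show "polygonal m (x i) \<le> (m - 2) * (int (5 * s))\<^sup>2" .
          show "0 \<le> a i" using a[of i] i by simp
        qed
        also have "\<dots> = int G * (int (5 * s))\<^sup>2"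
          unfolding G(2) by (simp add: sum_distrib_right sum_distrib_left mult_ac)
        also have "\<dots> < int L" using intL N0' of_nat_0_le_iff[of "M * H"] by linarith
        finally show "form_value m a 10 x < int L" .
      qed
    qed (use \<eta> H M rep dvdM in auto)
    have "H * (c0 * real s ^ 8) \<le> H * ((2 * \<eta> + 4096 * pi * H * M / (\<eta> ^ 6 * (real (5 * s))\<^sup>2)) * C * real (5 * s) ^ 8)"
      using lower upper by linarith
    then have "c0 * real s ^ 8 \<le> (2 * \<eta> + 4096 * pi * H * M / (\<eta> ^ 6 * (real (5 * s))\<^sup>2)) * C * real (5 * s) ^ 8"
      using H by (simp only: mult_le_cancel_left_pos of_nat_0_less_iff)
    also have "\<dots> = ((2 * \<eta> + 4096 * pi * H * M / (\<eta> ^ 6 * (real (5 * s))\<^sup>2)) * C * 390625) * real s ^ 8"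
      by (simp add: power_mult_distrib)
    finally have le: "c0 \<le> (2 * \<eta> + 4096 * pi * H * M / (\<eta> ^ 6 * (real (5 * s))\<^sup>2)) * C * 390625"
      using s1 by (simp add: mult_le_cancel_right)
    have "4096 * pi * H * M / (\<eta> ^ 6 * (real (5 * s))\<^sup>2) = 4096 * pi * 8 * A * M / (\<eta> ^ 6 * 25 * real s) * g"
      unfolding H_def using s1 \<eta> by (simp add: field_simps power2_eq_square)
    also have "\<dots> \<le> 4096 * pi * 8 * A * M / (\<eta> ^ 6 * 25 * real s) * (\<kappa> * s)"
      using g \<eta> by (intro mult_left_mono) auto
    also have "\<dots> = 4096 * pi * 8 * A * M / (\<eta> ^ 6 * 25) * \<kappa>"
      using s1 by simp
    also have "\<dots> \<le> 4096 * pi * 8 * A * M / (\<eta> ^ 6 * 25) * (c0 * 25 * \<eta> ^ 6 / (4 * 4096 * pi * 8 * real A * real M * C * 390625))"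
      using \<kappa> \<eta> by (intro mult_left_mono) auto
    also have "\<dots> = c0 / (4 * C * 390625)"
      using \<eta> A M C by (simp add: field_simps)
    finally have "2 * \<eta> + 4096 * pi * H * M / (\<eta> ^ 6 * (real (5 * s))\<^sup>2) \<le> 2 * (c0 / (8 * C * 390625)) + c0 / (4 * C * 390625)"
      using \<eta>(3) by linarith
    then have "(2 * \<eta> + 4096 * pi * H * M / (\<eta> ^ 6 * (real (5 * s))\<^sup>2)) * (C * 390625) \<le>
      (2 * (c0 / (8 * C * 390625)) + c0 / (4 * C * 390625)) * (C * 390625)"
      using C by (intro mult_right_mono) auto
    also have "\<dots> = c0 / 2" using C by (simp add: field_simps)
    finally show False using le c0 by (simp add: mult.assoc)
  qed
  show ?thesis
  proof (rule exI[of _ M], rule conjI[OF M], rule exI[of _ N0], rule exI[of _ "(int s0 + 1)\<^sup>2"], intro allI impI)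
    fix N assume N: "(int s0 + 1)\<^sup>2 \<le> N" and cong: "int M dvd N - N0"
    define s where "s = nat \<lfloor>sqrt (of_int N)\<rfloor>"
    have N0': "0 \<le> N" using N order_trans[OF zero_le_power2[of "int s0 + 1"]] by simp
    have "0 \<le> sqrt (of_int N)" using N0' by simp
    then have s: "real s \<le> sqrt (of_int N)" "sqrt (of_int N) < real s + 1"
      unfolding s_def by linarith+
    have "(real s)\<^sup>2 \<le> (sqrt (of_int N))\<^sup>2" using s by (intro power_mono) auto
    then have "real_of_int ((int s)\<^sup>2) \<le> of_int N" using N0' by simp
    then have 1: "(int s)\<^sup>2 \<le> N" by (simp only: of_int_le_iff)
    have "(sqrt (of_int N))\<^sup>2 < (real s + 1)\<^sup>2" using s N0' by (intro power_strict_mono) auto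
    then have "of_int N < real_of_int ((int s + 1)\<^sup>2)" using N0' by simp
    then have 2: "N < (int s + 1)\<^sup>2" by (simp only: of_int_less_iff)
    have "(int s0 + 1)\<^sup>2 < (int s + 1)\<^sup>2" using N 2 by linarith
    then have "int s0 + 1 < int s + 1" by (rule power_less_imp_less_base) simp
    then have "rep_count m a 10 (5 * s) N \<noteq> 0" using main 1 2 cong by simp
    then show "\<exists>x. form_value m a 10 x = N"
      unfolding rep_count_def by (auto simp: card_eq_0_iff)
  qed
qed

section \<open>Local solvability\<close>

lemma form_value_add:
  "form_value m a (k + l) x = form_value m a k x + form_value m (\<lambda>i. a (k + i)) l (\<lambda>i. x (k + i))"
  unfolding form_value_def by (induction l) auto

lemma form_value_cong:
  "(\<And>i. i < k \<Longrightarrow> x i = y i) \<Longrightarrow> form_value m a k x = form_value m a k y"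
  unfolding form_value_def by (intro sum.cong) auto

lemma form_value_extend:
  assumes "k \<le> k'"
  shows "\<exists>y. form_value m a k' y = form_value m a k x"
proof -
  let ?y = "\<lambda>i. if i < k then x i else 0"
  have "form_value m a (k + (k' - k)) ?y = form_value m a k x"
    unfolding form_value_add by (simp add: form_value_def)
  then show ?thesis using assms by auto
qed

section \<open>Varying one coordinate, and Hensel lifting for quadratics\<close>

lemma two_form_value:
  "2 * form_value m a k x = (\<Sum>i<k. a i * ((m - 2) * (x i)\<^sup>2 - (m - 4) * x i))"
  unfolding form_value_def sum_distrib_left two_times_polygonal [symmetric] by (simp add: mult.left_commute)

text \<open>Doubling clears the denominator of \<open>polygonal\<close>, so congruence of the
  arguments modulo M itself suffices, in contrast to \<open>form_value_dvd_diff\<close>.\<close>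

lemma two_form_value_dvd_diff:
  assumes "\<And>i. i < k \<Longrightarrow> M dvd x i - y i"
  shows "M dvd 2 * form_value m a k x - 2 * form_value m a k y"
proof -
  have "2 * form_value m a k x - 2 * form_value m a k y =
      (\<Sum>i<k. a i * (((m - 2) * (x i + y i) - (m - 4)) * (x i - y i)))"
    unfolding two_form_value sum_subtractf [symmetric]
    by (intro sum.cong refl) (simp add: algebra_simps power2_eq_square)
  then show ?thesis using assms by (auto intro!: dvd_sum dvd_mult)
qed

lemma two_form_value_fun_upd:
  assumes "i < k"
  shows "2 * form_value m a k (x(i := z)) = a i * (m - 2) * z\<^sup>2 + - (a i * (m - 4)) * z +
    (2 * form_value m a k x - a i * ((m - 2) * (x i)\<^sup>2 - (m - 4) * x i))"
proof -
  have "{..<k} = insert i ({..<k} - {i})" using assms by auto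
  then have "(\<Sum>j<k. f j) = f i + (\<Sum>j\<in>{..<k} - {i}. f j)" for f :: "nat \<Rightarrow> int"
    using sum.insert[of "{..<k} - {i}" i f] by simp
  moreover have "(\<Sum>j\<in>{..<k} - {i}. a j * ((m - 2) * ((x(i := z)) j)\<^sup>2 - (m - 4) * (x(i := z)) j)) =
      (\<Sum>j\<in>{..<k} - {i}. a j * ((m - 2) * (x j)\<^sup>2 - (m - 4) * x j))"
    by (intro sum.cong) auto
  ultimately show ?thesis
    unfolding two_form_value by (simp add: algebra_simps)
qed

text \<open>Hensel's lemma in its strong form. A root modulo p^(2s+1+n) is moved by t r with r =
  p^(s+1+n). The linear term contributes p^(2s+1+n) d t with d prime to p, so t can be chosen to
  cancel the error c modulo p; r^2 is divisible by the next power; and the derivative is unchanged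
  modulo p^(s+1), which keeps the induction going.\<close>

lemma hensel_quadratic:
  fixes p A B C x0 :: int
  assumes p: "prime p" and f: "p ^ (2 * s + 1) dvd A * x0\<^sup>2 + B * x0 + C"
    and d: "p ^ s dvd 2 * A * x0 + B" "\<not> p ^ (s + 1) dvd 2 * A * x0 + B"
  shows "\<exists>x. p ^ e dvd A * x\<^sup>2 + B * x + C"
proof -
  have p0: "p \<noteq> 0" using p by auto
  have step: "\<exists>x. p ^ (2 * s + 1 + n) dvd A * x\<^sup>2 + B * x + C \<and>
      p ^ s dvd 2 * A * x + B \<and> \<not> p ^ (s + 1) dvd 2 * A * x + B" for n
  proof (induction n)
    case 0
    then show ?case using f d by auto
  next
    case (Suc n)
    then obtain x c d where x: "A * x\<^sup>2 + B * x + C = p ^ (2 * s + 1 + n) * c" "2 * A * x + B = p ^ s * d"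
      "\<not> p ^ (s + 1) dvd 2 * A * x + B"
      by (metis dvdE)
    have "\<not> p dvd d" using x(2,3) p0 by (auto simp: power_add)
    then have "coprime d p" using p prime_imp_coprime coprime_commute by blast
    then obtain u where "[d * u = 1] (mod p)" using cong_solve_coprime_int by blast
    then have "p dvd c * (1 - d * u)" by (metis cong_sym cong_iff_dvd_diff dvd_mult)
    then have "p dvd c + d * (- c * u)" by (simp add: algebra_simps)
    then obtain w where w: "c + d * (- c * u) = p * w" by blast
    define t where "t = - c * u"
    define r where "r = p ^ (s + 1 + n)"
    have rs: "r * p ^ s = p ^ (2 * s + 1 + n)" unfolding r_def by (simp flip: power_add add: mult_2 add_ac)
    have r2: "r\<^sup>2 = p ^ (2 * s + 1 + Suc n) * p ^ n"
      unfolding r_def by (simp flip: power_add power_mult add: mult_2 algebra_simps)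
    have "A * (x + t * r)\<^sup>2 + B * (x + t * r) + C =
        (A * x\<^sup>2 + B * x + C) + (2 * A * x + B) * (t * r) + A * t\<^sup>2 * r\<^sup>2"
      by (simp add: power2_eq_square algebra_simps)
    also have "\<dots> = p ^ (2 * s + 1 + n) * c + (r * p ^ s) * (d * t) + A * t\<^sup>2 * r\<^sup>2"
      unfolding x by (simp add: mult_ac)
    also have "\<dots> = p ^ (2 * s + 1 + n) * (c + d * t) + A * t\<^sup>2 * r\<^sup>2"
      unfolding rs by (simp add: algebra_simps)
    also have "\<dots> = p ^ (2 * s + 1 + Suc n) * (w + A * t\<^sup>2 * p ^ n)"
      unfolding r2 w[folded t_def] by (simp add: algebra_simps)
    finally have 1: "p ^ (2 * s + 1 + Suc n) dvd A * (x + t * r)\<^sup>2 + B * (x + t * r) + C" by simp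
    have der: "2 * A * (x + t * r) + B = (2 * A * x + B) + p ^ (s + 1) * (2 * A * t * p ^ n)"
      unfolding r_def by (simp add: algebra_simps power_add)
    have 2: "p ^ s dvd 2 * A * (x + t * r) + B"
      unfolding der x(2) by (simp add: power_add mult.assoc)
    have 3: "\<not> p ^ (s + 1) dvd 2 * A * (x + t * r) + B"
      unfolding der using x(3) by (metis dvd_add_left_iff dvd_triv_left)
    show ?case using 1 2 3 by blast
  qed
  from step[of e] obtain x where "p ^ (2 * s + 1 + e) dvd A * x\<^sup>2 + B * x + C" by blast
  moreover have "p ^ e dvd p ^ (2 * s + 1 + e)" by (rule le_imp_power_dvd) simp
  ultimately show ?thesis using dvd_trans by blast
qed

lemma hensel_form_value:
  fixes p :: int
  assumes "prime p" "i < k" "p ^ (2 * s + 1) dvd 2 * form_value m a k x - 2 * T"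
    and "p ^ s dvd a i * (2 * (m - 2) * x i - (m - 4))" "\<not> p ^ (s + 1) dvd a i * (2 * (m - 2) * x i - (m - 4))"
  shows "\<exists>x'. p ^ e dvd 2 * form_value m a k x' - 2 * T"
proof -
  define C where "C = 2 * form_value m a k x - a i * ((m - 2) * (x i)\<^sup>2 - (m - 4) * x i) - 2 * T"
  have upd: "2 * form_value m a k (x(i := z)) - 2 * T = a i * (m - 2) * z\<^sup>2 + - (a i * (m - 4)) * z + C" for z
    unfolding two_form_value_fun_upd[OF assms(2)] C_def by simp
  have der: "2 * (a i * (m - 2)) * x i + - (a i * (m - 4)) = a i * (2 * (m - 2) * x i - (m - 4))"
    by (simp add: algebra_simps)
  have "\<exists>z. p ^ e dvd a i * (m - 2) * z\<^sup>2 + - (a i * (m - 4)) * z + C"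
    by (rule hensel_quadratic[of p s _ "x i"]) (use assms upd[of "x i"] der in simp_all)
  then show ?thesis using upd by metis
qed

text \<open>
  Among \<open>8 p\<close> coefficients in the same square class of the \<open>p\<close>-adic field, normalised to have
  congruent unit parts modulo \<open>8 p\<close>, the unit parts sum to \<open>0\<close> modulo \<open>8 p\<close>, and a single
  variable equal to 1 lifts this to an isotropic vector.
\<close>

lemma isotropic_vector:
  fixes p :: int and a :: "nat \<Rightarrow> int"
  assumes p: "prime p" and a: "\<And>i. a i > 0"
  shows "\<exists>K i0. i0 < K \<and> (\<forall>e. \<exists>t. p ^ e dvd (\<Sum>i<K. a i * (t i)\<^sup>2) \<and> \<not> p dvd t i0)"
proof -
  have p2: "p \<ge> 2" using p by (rule prime_ge_2_int)
  define v where "v = (\<lambda>i. multiplicity p (a i))"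
  define w where "w = (\<lambda>i. a i div p ^ v i)"
  have vw: "a i = p ^ v i * w i" "\<not> p dvd w i" for i
  proof -
    have "a i \<noteq> 0" "\<not> is_unit p" using a[of i] p by auto
    from multiplicity_decompose[OF this] show "a i = p ^ v i * w i" "\<not> p dvd w i"
      unfolding v_def w_def by (simp_all add: multiplicity_dvd)
  qed
  define cls where "cls = (\<lambda>i. (v i mod 2, w i mod (8 * p)))"
  have "cls ` UNIV \<subseteq> {0..<2} \<times> {0..<8 * p}" unfolding cls_def using p2 by auto
  then have "finite (cls ` UNIV)" by (meson finite_SigmaI finite_atLeastLessThan finite_atLeastLessThan_int finite_subset)
  then obtain j where "infinite {i\<in>UNIV. cls i = cls j}"
    using pigeonhole_infinite[of UNIV cls] by auto
  then obtain J where J: "finite J" "card J = nat (8 * p)" "J \<subseteq> {i. cls i = cls j}"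
    using infinite_arbitrarily_large[of "{i. cls i = cls j}" "nat (8 * p)"] by auto
  have Jne: "J \<noteq> {}" using J p2 by auto
  \<comment> \<open>The coordinate i0 to be lifted has the largest valuation, so every other
    coefficient can be brought to p^V times its unit part by an even power of p.\<close>
  define V where "V = Max (v ` J)"
  have "V \<in> v ` J" unfolding V_def using J Jne by auto
  then obtain i0 where i0: "i0 \<in> J" "v i0 = V" by auto
  have vV: "v i \<le> V" if "i \<in> J" for i unfolding V_def using J that by auto
  have par: "v i mod 2 = V mod 2" if "i \<in> J" for i
    using subsetD[OF J(3) that] subsetD[OF J(3) i0(1)] i0(2) unfolding cls_def by simp
  have wmod: "w i mod (8 * p) = w i0 mod (8 * p)" if "i \<in> J" for i
    using subsetD[OF J(3) that] subsetD[OF J(3) i0(1)] i0(2) unfolding cls_def by simp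
  define S where "S = (\<Sum>i\<in>J - {i0}. w i)"
  have "8 * p dvd (\<Sum>i\<in>J. w i - w i0)"
    using wmod by (intro dvd_sum) (simp add: mod_eq_dvd_iff)
  moreover have "(\<Sum>i\<in>J. w i) = w i0 + S" unfolding S_def using i0 J by (simp add: sum.remove)
  ultimately have "8 * p dvd w i0 + S - 8 * p * w i0"
    using J p2 by (simp add: sum_subtractf)
  then have S: "8 * p dvd w i0 + S"
    by (metis diff_add_cancel dvd_add dvd_triv_left)
  \<comment> \<open>The derivative at 1 has valuation 1 for p = 2 and 0 for odd p. Hensel lifting
    then asks for precision p^3 = 8 and p respectively, and both divide 8 p.\<close>
  have lift: "\<exists>x. p ^ e dvd w i0 * x\<^sup>2 + 0 * x + S" for e
  proof (cases "p = 2")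
    case True
    show ?thesis
    proof (rule hensel_quadratic[of p 1 _ 1])
      show "p ^ (2 * 1 + 1) dvd w i0 * 1\<^sup>2 + 0 * 1 + S"
        using S dvd_trans[of "8" "8 * p"] True by simp
      show "\<not> p ^ (1 + 1) dvd 2 * w i0 * 1 + 0" using vw(2)[of i0] True by simp presburger
    qed (use p True in auto)
  next
    case False
    show ?thesis
    proof (rule hensel_quadratic[of p 0 _ 1])
      have "\<not> p dvd 2"
      proof
        assume "p dvd 2"
        then have "p \<le> 2" by (rule zdvd_imp_le) simp
        then show False using False p2 by simp
      qed
      then show "\<not> p ^ (0 + 1) dvd 2 * w i0 * 1 + 0" using vw(2)[of i0] p by (simp add: prime_dvd_mult_iff)
      show "p ^ (2 * 0 + 1) dvd w i0 * 1\<^sup>2 + 0 * 1 + S"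
        using S dvd_trans[of p "8 * p"] by simp
    qed (use p in auto)
  qed
  define K where "K = Suc (Max J)"
  have K: "i < K" if "i \<in> J" for i unfolding K_def using that J by (simp add: le_imp_less_Suc)
  have "\<exists>t. p ^ e dvd (\<Sum>i<K. a i * (t i)\<^sup>2) \<and> \<not> p dvd t i0" for e
  proof -
    \<comment> \<open>One extra power makes p itself divide the value even when e = 0, as the proof
      that p does not divide x requires.\<close>
    obtain x where x: "p ^ (e + 1) dvd w i0 * x\<^sup>2 + S" using lift[of "e + 1"] by auto
    define t where "t = (\<lambda>i. if i = i0 then x else if i \<in> J then p ^ ((V - v i) div 2) else 0)"
    have "(\<Sum>i<K. a i * (t i)\<^sup>2) = (\<Sum>i\<in>J. a i * (t i)\<^sup>2)"
      using K i0 by (intro sum.mono_neutral_right) (auto simp: t_def)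
    also have "\<dots> = a i0 * x\<^sup>2 + (\<Sum>i\<in>J - {i0}. a i * (t i)\<^sup>2)"
      using i0 J by (subst sum.remove[of J i0]) (auto simp: t_def)
    also have "(\<Sum>i\<in>J - {i0}. a i * (t i)\<^sup>2) = (\<Sum>i\<in>J - {i0}. p ^ V * w i)"
    proof (intro sum.cong refl)
      fix i assume i: "i \<in> J - {i0}"
      have "v i mod 2 = V mod 2" using par i by blast
      moreover have "k mod 2 = l mod 2 \<Longrightarrow> even (l - k)" for k l :: nat by presburger
      ultimately have "even (V - v i)" by blast
      then have "v i + (V - v i) div 2 * 2 = V" using vV[of i] i by simp
      then have "p ^ v i * (p ^ ((V - v i) div 2))\<^sup>2 = p ^ V"
        by (metis power_add power_mult)
      then show "a i * (t i)\<^sup>2 = p ^ V * w i"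
        using i vw(1)[of i] unfolding t_def by simp
    qed
    also have "a i0 * x\<^sup>2 + (\<Sum>i\<in>J - {i0}. p ^ V * w i) = p ^ V * (w i0 * x\<^sup>2 + S)"
      using vw(1)[of i0] i0 unfolding S_def by (simp add: sum_distrib_left algebra_simps)
    finally have eq: "(\<Sum>i<K. a i * (t i)\<^sup>2) = p ^ V * (w i0 * x\<^sup>2 + S)" .
    have "p ^ e dvd w i0 * x\<^sup>2 + S" using x dvd_trans[of "p ^ e" "p ^ (e + 1)"] by simp
    then have 1: "p ^ e dvd (\<Sum>i<K. a i * (t i)\<^sup>2)" unfolding eq by (rule dvd_mult)
    have "\<not> p dvd x"
    proof
      assume "p dvd x"
      then have "p dvd w i0 * x\<^sup>2" by (simp add: power2_eq_square)
      moreover have "p dvd w i0 * x\<^sup>2 + S" using x dvd_trans[of p "p ^ (e + 1)"] by simp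
      ultimately have "p dvd S" by (simp add: dvd_add_right_iff)
      moreover have "p dvd w i0 + S" using S dvd_trans[of p "8 * p"] by simp
      ultimately have "p dvd w i0" by (simp add: dvd_add_left_iff)
      then show False using vw(2) by blast
    qed
    then have "\<not> p dvd t i0" unfolding t_def by simp
    then show ?thesis using 1 by blast
  qed
  then show ?thesis using K[OF i0(1)] by blast
qed

text \<open>Both sides are doubled so that Hensel lifting and the Chinese remainder theorem act on
  integer polynomials; \<open>locally_solvable\<close> removes the 2 by passing to the modulus 2
  M.\<close>

definition solvable_mod :: "int \<Rightarrow> (nat \<Rightarrow> int) \<Rightarrow> nat \<Rightarrow> int \<Rightarrow> int \<Rightarrow> bool" where
  "solvable_mod m a k M T \<longleftrightarrow> (\<exists>x. M dvd 2 * form_value m a k x - 2 * T)"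

lemma solvable_mod_extend:
  assumes "solvable_mod m a k M T" "k \<le> k'"
  shows "solvable_mod m a k' M T"
  using assms form_value_extend[of k k' m a] unfolding solvable_mod_def by metis

lemma solvable_mod_cong:
  assumes "solvable_mod m a k M S" "M dvd S - T"
  shows "solvable_mod m a k M T"
proof -
  obtain x where "M dvd 2 * form_value m a k x - 2 * S" using assms(1) unfolding solvable_mod_def by blast
  moreover have "M dvd 2 * (S - T)" using assms(2) by (rule dvd_mult)
  ultimately have "M dvd (2 * form_value m a k x - 2 * S) + 2 * (S - T)" by (rule dvd_add)
  then show ?thesis unfolding solvable_mod_def by (auto simp: algebra_simps)
qed

lemma exact_power_dvd:
  fixes p z :: int
  assumes "prime p" "z \<noteq> 0"
  shows "p ^ multiplicity p z dvd z" "\<not> p ^ (multiplicity p z + 1) dvd z"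
proof -
  have "\<not> is_unit p" using assms by auto
  then show "\<not> p ^ (multiplicity p z + 1) dvd z"
    using power_dvd_iff_le_multiplicity[OF assms(2), of p "multiplicity p z + 1"] by simp
qed (rule multiplicity_dvd)

text \<open>
  A solution modulo a fixed power of \<open>p\<close> either has a variable with small derivative valuation,
  or its first variables may be translated by an isotropic vector to produce one.
\<close>

lemma local_lifting:
  fixes p :: int
  assumes p: "prime p" and m: "m \<ge> 3" and a: "\<And>i. a i > 0"
  shows "\<exists>E K. \<forall>k\<ge>K. \<forall>T. solvable_mod m a k (p ^ E) T \<longrightarrow> (\<forall>e. solvable_mod m a k (p ^ e) T)"
proof -
  obtain K i0 where i0: "i0 < K"
    and iso: "\<And>e. \<exists>t. p ^ e dvd (\<Sum>i<K. a i * (t i)\<^sup>2) \<and> \<not> p dvd t i0"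
    using isotropic_vector[of p a] p a by blast
  \<comment> \<open>Moving \<open>x i0\<close> by \<open>t i0\<close> changes the derivative by a i0
    * 2 (m - 2) * t i0, of valuation exactly s1, so f = 2 s1 + 1 is the precision needed after a
    translation. If p^f does not divide some \<open>?y i\<close> with i < K, the derivative there
    has valuation at most f + V, and E = 2 (f + V) + 1 is the precision needed.\<close>
  define s1 where "s1 = multiplicity p (a i0 * (2 * (m - 2)))"
  define f where "f = 2 * s1 + 1"
  define V where "V = Max ((\<lambda>i. multiplicity p (a i)) ` {..<K})"
  define E where "E = 2 * (f + V) + 1"
  have V: "multiplicity p (a i) \<le> V" if "i < K" for i unfolding V_def using that by auto
  have "solvable_mod m a k (p ^ e) T" if k: "K \<le> k" and sol: "solvable_mod m a k (p ^ E) T" for k T e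
  proof -
    obtain x where x: "p ^ E dvd 2 * form_value m a k x - 2 * T" using sol unfolding solvable_mod_def by blast
    let ?y = "\<lambda>i. 2 * (m - 2) * x i - (m - 4)"
    show ?thesis
    proof (cases "\<exists>i<K. \<not> p ^ f dvd ?y i")
      case True
      then obtain i where i: "i < K" "\<not> p ^ f dvd ?y i" by blast
      define s where "s = multiplicity p (a i * ?y i)"
      have y0: "?y i \<noteq> 0" using i by auto
      have ai: "a i \<noteq> 0" using a[of i] by simp
      have "multiplicity p (?y i) < f"
        using i(2) y0 p by (metis exact_power_dvd(1) le_imp_power_dvd dvd_trans not_le)
      then have "s \<le> f + V"
        unfolding s_def using p y0 ai V[OF i(1)] by (subst prime_elem_multiplicity_mult_distrib) auto
      then have "p ^ (2 * s + 1) dvd p ^ E" unfolding E_def by (intro le_imp_power_dvd) simp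
      then have "p ^ (2 * s + 1) dvd 2 * form_value m a k x - 2 * T" using x dvd_trans by blast
      moreover have "a i * ?y i \<noteq> 0" using y0 ai by simp
      ultimately show ?thesis
        unfolding solvable_mod_def
        using hensel_form_value[of p i k s m a x T e] exact_power_dvd[of p "a i * ?y i"] p i k
        unfolding s_def by simp
    next
      case False
      then have y: "p ^ f dvd ?y i" if "i < K" for i using that by blast
      obtain t where t: "p ^ f dvd (\<Sum>i<K. a i * (t i)\<^sup>2)" "\<not> p dvd t i0" using iso by blast
      \<comment> \<open>The translation preserves the congruence modulo p^f: the quadratic terms
        vanish because t is isotropic, the linear ones because p^f divides every
        \<open>?y i\<close>.\<close>
      define x' where "x' = (\<lambda>i. if i < K then x i + t i else x i)"
      have "2 * form_value m a k x' - 2 * form_value m a k x =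
          (\<Sum>i<k. if i < K then a i * ((m - 2) * (t i)\<^sup>2 + ?y i * t i) else 0)"
        unfolding two_form_value sum_subtractf [symmetric] x'_def
        by (intro sum.cong refl) (simp add: algebra_simps power2_eq_square)
      also have "\<dots> = (\<Sum>i<K. a i * ((m - 2) * (t i)\<^sup>2 + ?y i * t i))"
        using k by (intro sum.mono_neutral_cong_right) auto
      also have "\<dots> = (m - 2) * (\<Sum>i<K. a i * (t i)\<^sup>2) + (\<Sum>i<K. a i * t i * ?y i)"
        unfolding sum_distrib_left sum.distrib [symmetric]
        by (intro sum.cong refl) (simp add: algebra_simps)
      finally have diff: "2 * form_value m a k x' - 2 * form_value m a k x =
        (m - 2) * (\<Sum>i<K. a i * (t i)\<^sup>2) + (\<Sum>i<K. a i * t i * ?y i)" .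
      have "p ^ f dvd (\<Sum>i<K. a i * t i * ?y i)" using y by (intro dvd_sum dvd_mult) auto
      then have "p ^ f dvd 2 * form_value m a k x' - 2 * form_value m a k x"
        unfolding diff using t by (intro dvd_add dvd_mult)
      moreover have "p ^ f dvd 2 * form_value m a k x - 2 * T"
        using x dvd_trans[OF le_imp_power_dvd[of f E p]] unfolding E_def by simp
      ultimately have "p ^ f dvd (2 * form_value m a k x' - 2 * form_value m a k x) + (2 * form_value m a k x - 2 * T)"
        by (rule dvd_add)
      then have sol': "p ^ (2 * s1 + 1) dvd 2 * form_value m a k x' - 2 * T"
        unfolding f_def by simp
      let ?c = "a i0 * (2 * (m - 2))"
      have c: "p ^ s1 dvd ?c" "\<not> p ^ (s1 + 1) dvd ?c"
        using exact_power_dvd[of p ?c] p a[of i0] m unfolding s1_def by auto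
      \<comment> \<open>The old derivative vanishes modulo p^(s1+1), so the new one inherits the
        exact valuation s1 of the second term.\<close>
      have der: "a i0 * (2 * (m - 2) * x' i0 - (m - 4)) = a i0 * ?y i0 + ?c * t i0"
        unfolding x'_def using i0 by (simp add: algebra_simps)
      have ay: "p ^ (s1 + 1) dvd a i0 * ?y i0"
        using y[OF i0] dvd_trans[OF le_imp_power_dvd[of "s1 + 1" f p]] unfolding f_def by (intro dvd_mult) simp
      then have "p ^ s1 dvd a i0 * ?y i0" by (meson dvd_trans le_add1 le_imp_power_dvd)
      then have 1: "p ^ s1 dvd a i0 * (2 * (m - 2) * x' i0 - (m - 4))"
        unfolding der using c(1) by (intro dvd_add) auto
      have "\<not> p ^ (s1 + 1) dvd ?c * t i0"
      proof
        assume *: "p ^ (s1 + 1) dvd ?c * t i0"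
        have "coprime p (t i0)" using t(2) p prime_imp_coprime by blast
        then have "coprime (p ^ (s1 + 1)) (t i0)" by (simp del: power_Suc)
        then show False using * c(2) by (simp add: coprime_dvd_mult_left_iff)
      qed
      then have 2: "\<not> p ^ (s1 + 1) dvd a i0 * (2 * (m - 2) * x' i0 - (m - 4))"
        unfolding der using ay by (simp add: dvd_add_right_iff)
      show ?thesis
        unfolding solvable_mod_def
        by (rule hensel_form_value[OF p _ sol' 1 2]) (use i0 k in simp)
    qed
  qed
  then show ?thesis by blast
qed

section \<open>Gluing local solutions into a finite prefix\<close>

lemma uniform_finite_choice:
  fixes P :: "'a \<Rightarrow> nat \<Rightarrow> bool"
  assumes "finite A" "\<And>r. r \<in> A \<Longrightarrow> \<exists>k. P r k" "\<And>r k k'. P r k \<Longrightarrow> k \<le> k' \<Longrightarrow> P r k'"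
  shows "\<exists>k\<ge>l. \<forall>r\<in>A. P r k"
proof -
  obtain g where g: "\<And>r. r \<in> A \<Longrightarrow> P r (g r)" using assms(2) by metis
  have "P r (l + sum g A)" if "r \<in> A" for r
    using assms(3)[OF g[OF that]] member_le_sum[of r A g] that assms(1) by (simp add: trans_le_add2)
  then show ?thesis by (meson le_add1)
qed

text \<open>Modulo p^E there are finitely many classes, and each contains some N >= n, which is a
  value of a prefix by \<open>cover\<close>. A long prefix thus meets them all, and since the E of
  \<open>local_lifting\<close> does not depend on the prefix, every class lifts.\<close>

lemma locally_solvable_prime:
  fixes p :: int
  assumes p: "prime p" and m: "m \<ge> 3" and a: "\<And>i. a i > 0"
    and cover: "\<And>N. N \<ge> n \<Longrightarrow> \<exists>k x. form_value m a k x = N"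
  shows "\<exists>k. \<forall>e T. solvable_mod m a k (p ^ e) T"
proof -
  obtain E K where EK: "\<And>k T e. K \<le> k \<Longrightarrow> solvable_mod m a k (p ^ E) T \<Longrightarrow> solvable_mod m a k (p ^ e) T"
    using local_lifting[OF p m, of a] a by blast
  have pE: "p ^ E > 0" using p by (simp add: prime_gt_0_int)
  have "\<exists>k\<ge>K. \<forall>r\<in>{0..<p ^ E}. solvable_mod m a k (p ^ E) r"
  proof (rule uniform_finite_choice)
    fix r assume "r \<in> {0..<p ^ E}"
    then have r: "0 \<le> r" by simp
    have "1 * \<bar>n\<bar> \<le> p ^ E * \<bar>n\<bar>" using pE by (intro mult_right_mono) auto
    then have "n \<le> r + p ^ E * \<bar>n\<bar>" using r by linarith
    then obtain k x where "form_value m a k x = r + p ^ E * \<bar>n\<bar>" using cover by blast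
    then have "2 * form_value m a k x - 2 * r = p ^ E * (2 * \<bar>n\<bar>)" by simp
    then show "\<exists>k. solvable_mod m a k (p ^ E) r" unfolding solvable_mod_def by (metis dvd_triv_left)
  qed (auto intro: solvable_mod_extend)
  then obtain k where k: "K \<le> k" "\<And>r. r \<in> {0..<p ^ E} \<Longrightarrow> solvable_mod m a k (p ^ E) r" by blast
  have "solvable_mod m a k (p ^ e) T" for e T
  proof (rule EK[OF k(1)])
    have "solvable_mod m a k (p ^ E) (T mod p ^ E)" using k(2) pE by simp
    then show "solvable_mod m a k (p ^ E) T" by (rule solvable_mod_cong) (simp flip: mod_eq_dvd_iff)
  qed
  then show ?thesis by blast
qed

lemma solvable_mod_coprime_mult:
  assumes "coprime M1 M2" "solvable_mod m a k M1 T" "solvable_mod m a k M2 T"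
  shows "solvable_mod m a k (M1 * M2) T"
proof -
  obtain x y where x: "M1 dvd 2 * form_value m a k x - 2 * T" and y: "M2 dvd 2 * form_value m a k y - 2 * T"
    using assms unfolding solvable_mod_def by blast
  have "\<forall>i. \<exists>z. [z = x i] (mod M1) \<and> [z = y i] (mod M2)"
    using binary_chinese_remainder_int[OF assms(1)] by blast
  then obtain z where z: "\<And>i. [z i = x i] (mod M1)" "\<And>i. [z i = y i] (mod M2)" by metis
  have "M1 dvd (2 * form_value m a k z - 2 * form_value m a k x) + (2 * form_value m a k x - 2 * T)"
    using x z(1) by (intro dvd_add two_form_value_dvd_diff) (auto simp: cong_iff_dvd_diff)
  moreover have "M2 dvd (2 * form_value m a k z - 2 * form_value m a k y) + (2 * form_value m a k y - 2 * T)"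
    using y z(2) by (intro dvd_add two_form_value_dvd_diff) (auto simp: cong_iff_dvd_diff)
  ultimately show ?thesis
    unfolding solvable_mod_def using assms(1) by (intro exI[of _ z] divides_mult) auto
qed

lemma solvable_mod_of_prime_powers:
  assumes "\<And>p e. prime p \<Longrightarrow> solvable_mod m a k (p ^ e) T" "M > 0"
  shows "solvable_mod m a k M T"
  using assms(2)
proof (induction "nat M" arbitrary: M rule: less_induct)
  case less
  show ?case
  proof (cases "M = 1")
    case False
    then obtain p where p: "prime p" "p dvd M"
      using less.prems prime_divisor_exists[of M] by auto
    have "M \<noteq> 0" "\<not> is_unit p" using less.prems p by auto
    from multiplicity_decompose'[OF this] obtain M' where M': "M = p ^ multiplicity p M * M'" "\<not> p dvd M'"
      by blast
    have "0 < p ^ multiplicity p M" using p by (simp add: prime_gt_0_int)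
    then have pos: "M' > 0" using M'(1) less.prems by (metis zero_less_mult_pos)
    have "multiplicity p M > 0" using p M'(2) M'(1) by (metis mult_1 power_0 neq0_conv)
    then have "1 < p ^ multiplicity p M" using prime_gt_1_int[OF p(1)] by simp
    then have "1 * M' < p ^ multiplicity p M * M'" using pos by (intro mult_strict_right_mono) auto
    then have "nat M' < nat M" using M'(1) pos by simp
    then have "solvable_mod m a k M' T" using less.hyps pos by blast
    moreover have "coprime p M'" using p M'(2) prime_imp_coprime by blast
    then have "coprime (p ^ multiplicity p M) M'" by simp
    ultimately show ?thesis
      using solvable_mod_coprime_mult assms(1)[OF p(1)] M'(1) by metis
  qed (simp add: solvable_mod_def)
qed

text \<open>For a prime not dividing the modulus M0, the progression represented by ten variables
  already contains large members of every class modulo p^e, by the Chinese remainder theorem. Only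
  the primes dividing M0 need \<open>locally_solvable_prime\<close>, and being finitely many they
  share one prefix.\<close>

lemma locally_solvable:
  assumes m: "m \<ge> 3" and a: "\<And>i. a i > 0" and cover: "\<And>N. N \<ge> n \<Longrightarrow> \<exists>k x. form_value m a k x = N"
  shows "\<exists>k. \<forall>M>0. \<forall>T. \<exists>x. M dvd form_value m a k x - T"
proof -
  obtain M0 :: nat and N0 B where M0: "M0 > 0"
    and prog: "\<And>N. N \<ge> B \<Longrightarrow> int M0 dvd N - N0 \<Longrightarrow> \<exists>x. form_value m a 10 x = N"
    using represents_progression[of m a] m a by blast
  have "finite {p. prime p \<and> p dvd int M0}"
    by (rule finite_subset[of _ "{d. d dvd int M0}"]) (use M0 in auto)
  then have "\<exists>k\<ge>10. \<forall>p\<in>{p. prime p \<and> p dvd int M0}. \<forall>e T. solvable_mod m a k (p ^ e) T"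
  proof (rule uniform_finite_choice)
    fix p assume "p \<in> {p. prime p \<and> p dvd int M0}"
    then show "\<exists>k. \<forall>e T. solvable_mod m a k (p ^ e) T"
      using locally_solvable_prime[of p m a n] m a cover by blast
  qed (blast intro: solvable_mod_extend)
  then obtain k where k: "k \<ge> 10"
    "\<And>p e T. prime p \<Longrightarrow> p dvd int M0 \<Longrightarrow> solvable_mod m a k (p ^ e) T" by blast
  have prime_power: "solvable_mod m a k (p ^ e) T" if p: "prime p" for p e T
  proof (cases "p dvd int M0")
    case True
    then show ?thesis using k p by blast
  next
    case False
    then have "coprime p (int M0)" using p prime_imp_coprime by blast
    then have "coprime (p ^ e) (int M0)" by simp
    then obtain N' where N': "[N' = T] (mod p ^ e)" "[N' = N0] (mod int M0)"
      using binary_chinese_remainder_int by blast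
    define c where "c = \<bar>B\<bar> + \<bar>N'\<bar>"
    define N where "N = N' + p ^ e * int M0 * c"
    have "1 * c \<le> p ^ e * int M0 * c"
    proof (intro mult_right_mono)
      have "0 < p ^ e * int M0" using p M0 by (simp add: prime_gt_0_int)
      then show "1 \<le> p ^ e * int M0" by linarith
    qed (simp add: c_def)
    moreover have "B \<le> N' + c" unfolding c_def by linarith
    ultimately have "N \<ge> B" unfolding N_def by linarith
    moreover have "int M0 dvd (N' - N0) + int M0 * (p ^ e * c)"
      using N'(2) by (simp add: cong_iff_dvd_diff)
    then have "int M0 dvd N - N0" unfolding N_def by (simp add: algebra_simps)
    ultimately obtain x where x: "form_value m a 10 x = N" using prog by blast
    have "p ^ e dvd (N' - T) + p ^ e * (int M0 * c)"
      using N'(1) by (simp add: cong_iff_dvd_diff)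
    then have NT: "p ^ e dvd N - T" unfolding N_def by (simp add: algebra_simps)
    have "solvable_mod m a 10 (p ^ e) N" unfolding solvable_mod_def using x by (intro exI[of _ x]) simp
    then show ?thesis by (rule solvable_mod_extend[OF solvable_mod_cong[OF _ NT] k(1)])
  qed
  have "\<exists>x. M dvd form_value m a k x - T" if "M > 0" for M T
  proof -
    have "solvable_mod m a k (2 * M) T" 
      by (rule solvable_mod_of_prime_powers[OF prime_power]) (use that in simp_all)
    then obtain x where "2 * M dvd 2 * (form_value m a k x - T)"
      unfolding solvable_mod_def by (auto simp: right_diff_distrib)
    then have "M dvd form_value m a k x - T" 
      by (subst (asm) dvd_mult_cancel_left) simp
    then show ?thesis by blast
  qed
  then show ?thesis by blast
qed

text \<open>The first k1 variables correct the residue class of N and the next ten represent the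
  remainder. Only M classes occur, so a single W bounds all corrections and keeps the remainder
  above B once N >= B + W. The finitely many smaller N need only finitely many further
  coefficients.\<close>

theorem finite_prefix_suffices:
  assumes m: "m \<ge> 3" and a: "\<And>i. a i > 0" and cover: "\<And>N. N \<ge> n \<Longrightarrow> \<exists>k x. form_value m a k x = N"
  shows "\<exists>k. \<forall>N\<ge>n. \<exists>x. form_value m a k x = N"
proof -
  obtain k1 where k1: "\<And>M T. M > 0 \<Longrightarrow> \<exists>x. M dvd form_value m a k1 x - T"
    using locally_solvable[of m a n] m a cover by blast
  obtain M :: nat and N0 B where M: "M > 0" and prog: "\<And>N. N \<ge> B \<Longrightarrow> int M dvd N - N0 \<Longrightarrow>
      \<exists>x. form_value m (\<lambda>i. a (k1 + i)) 10 x = N"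
    using represents_progression[of m "\<lambda>i. a (k1 + i)"] m a by blast
  obtain z where z: "\<And>r. int M dvd form_value m a k1 (z r) - r"
    using k1[of "int M"] M by (metis of_nat_0_less_iff)
  define W where "W = (\<Sum>r\<in>{0..<int M}. form_value m a k1 (z r))"
  have large: "\<exists>x. form_value m a (k1 + 10) x = N" if N: "N \<ge> B + W" for N
  proof -
    define r where "r = (N - N0) mod int M"
    have r: "r \<in> {0..<int M}" unfolding r_def using M by simp
    have "form_value m a k1 (z r) \<le> W"
      unfolding W_def using r m a by (intro member_le_sum) (auto intro: form_value_nonneg)
    then have 1: "N - form_value m a k1 (z r) \<ge> B" using N by linarith
    have "int M dvd (N - N0) - r" unfolding r_def by (simp flip: mod_eq_dvd_iff)
    then have "int M dvd ((N - N0) - r) - (form_value m a k1 (z r) - r)" using z by (rule dvd_diff)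
    then have "int M dvd (N - form_value m a k1 (z r)) - N0" by (simp add: algebra_simps)
    then obtain x where x: "form_value m (\<lambda>i. a (k1 + i)) 10 x = N - form_value m a k1 (z r)" using prog[OF 1] by blast
    let ?y = "\<lambda>i. if i < k1 then z r i else x (i - k1)"
    have "form_value m a k1 ?y = form_value m a k1 (z r)" by (rule form_value_cong) simp
    then have "form_value m a (k1 + 10) ?y = N" unfolding form_value_add using x by simp
    then show ?thesis by blast
  qed
  have "\<exists>k\<ge>k1 + 10. \<forall>N\<in>{n..B + W}. \<exists>x. form_value m a k x = N"
  proof (rule uniform_finite_choice)
    fix N k k' assume "\<exists>x. form_value m a k x = N" "k \<le> k'"
    then show "\<exists>x. form_value m a k' x = N" using form_value_extend by metis
  qed (use cover in auto)
  then obtain k where k: "k \<ge> k1 + 10" "\<And>N. N \<in> {n..B + W} \<Longrightarrow> \<exists>x. form_value m a k x = N" by blast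
  have "\<exists>x. form_value m a k x = N" if "N \<ge> n" for N
  proof (cases "N \<le> B + W")
    case False
    then obtain x where "form_value m a (k1 + 10) x = N" using large[of N] by auto
    then show ?thesis using form_value_extend[OF k(1)] by metis
  qed (use k that in auto)
  then show ?thesis by blast
qed

section \<open>Escalation\<close>

text \<open>A recursive counterpart of \<open>form_value\<close> on lists, suited to appending,
  permuting and deleting coefficients during escalation.\<close>

fun represents :: "int \<Rightarrow> int list \<Rightarrow> int \<Rightarrow> bool" where
  "represents m [] N \<longleftrightarrow> N = 0"
| "represents m (c # w) N \<longleftrightarrow> (\<exists>y. represents m w (N - c * polygonal m y))"

lemma represents_iff_form_value:
  "represents m w N \<longleftrightarrow> (\<exists>x. form_value m ((!) w) (length w) x = N)"
proof (induction w arbitrary: N)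
  case Nil
  then show ?case by (auto simp: form_value_def)
next
  case (Cons c w)
  have eq: "form_value m ((!) (c # w)) (length (c # w)) x = c * polygonal m (x 0) + form_value m ((!) w) (length w) (\<lambda>i. x (Suc i))" for x
    using form_value_add[of m "(!) (c # w)" 1 "length w" x] by (simp add: form_value_def)
  show ?case
  proof
    assume "represents m (c # w) N"
    then obtain y x where "form_value m ((!) w) (length w) x = N - c * polygonal m y" using Cons by auto
    then show "\<exists>x. form_value m ((!) (c # w)) (length (c # w)) x = N"
      unfolding eq by (intro exI[of _ "case_nat y x"]) simp
  next
    assume "\<exists>x. form_value m ((!) (c # w)) (length (c # w)) x = N"
    then obtain x where "c * polygonal m (x 0) + form_value m ((!) w) (length w) (\<lambda>i. x (Suc i)) = N"
      unfolding eq by blast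
    then have "form_value m ((!) w) (length w) (\<lambda>i. x (Suc i)) = N - c * polygonal m (x 0)" by simp
    then show "represents m (c # w) N" using Cons by auto
  qed
qed

lemma represents_append:
  "represents m (u @ v) N \<longleftrightarrow> (\<exists>s. represents m u s \<and> represents m v (N - s))"
proof (induction u arbitrary: N)
  case (Cons c u)
  show ?case
  proof
    assume "represents m ((c # u) @ v) N"
    then obtain y s where "represents m u s" "represents m v (N - c * polygonal m y - s)" using Cons by auto
    then show "\<exists>s. represents m (c # u) s \<and> represents m v (N - s)"
      by (intro exI[of _ "s + c * polygonal m y"]) (auto intro!: exI[of _ y] simp: algebra_simps)
  next
    assume "\<exists>s. represents m (c # u) s \<and> represents m v (N - s)"
    then obtain s y where "represents m u (s - c * polygonal m y)" "represents m v (N - s)" by auto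
    then have "represents m (u @ v) (N - c * polygonal m y)"
      unfolding Cons.IH by (intro exI[of _ "s - c * polygonal m y"]) simp
    then show "represents m ((c # u) @ v) N" by auto
  qed
qed simp

lemma represents_mset:
  assumes "represents m u N" "mset u = mset v"
  shows "represents m v N"
  using assms
proof (induction v arbitrary: u N)
  case (Cons c v)
  then have "c \<in> set u" by (metis list.set_intros(1) mset_eq_setD)
  then obtain u1 u2 where u: "u = u1 @ c # u2" by (meson split_list)
  obtain s y where "represents m u1 s" "represents m u2 (N - s - c * polygonal m y)"
    using Cons.prems(1) unfolding u represents_append by auto
  then have "represents m (u1 @ u2) (N - c * polygonal m y)"
    unfolding represents_append by (intro exI[of _ s]) (simp add: algebra_simps)
  moreover have "mset (u1 @ u2) = mset v" using Cons.prems(2) u by simp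
  ultimately have "represents m v (N - c * polygonal m y)" by (rule Cons.IH)
  then show ?case by auto
qed simp

lemma represents_zero: "represents m u 0"
  by (induction u) (auto intro!: exI[of _ 0])

lemma represents_append_left: "represents m u N \<Longrightarrow> represents m (u @ v) N"
  unfolding represents_append using represents_zero by (intro exI[of _ N]) simp

lemma represents_submset:
  assumes "represents m u N" "mset u \<subseteq># mset v"
  shows "represents m v N"
proof -
  obtain w where "mset w = mset v - mset u" using ex_mset by blast
  then have "mset (u @ w) = mset v" using assms(2) by simp
  then show ?thesis using represents_append_left[OF assms(1)] represents_mset by blast
qed

text \<open>Coefficients whose polygonal value is 0 are discarded. Each remaining one contributes at
  least itself, hence at least 1, so there are at most N of them and each is at most N. This makes
  the escalator tree finitely branching.\<close>

lemma represents_bounded_part: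
  assumes m: "m \<ge> 3" and "represents m u N" "\<forall>c\<in>set u. c > 0"
  shows "0 \<le> N \<and> (\<exists>v. mset v \<subseteq># mset u \<and> represents m v N \<and> int (length v) \<le> N \<and> (\<forall>c\<in>set v. c \<le> N))"
  using assms(2,3)
proof (induction u arbitrary: N)
  case Nil
  then show ?case by (auto intro!: exI[of _ "[]"])
next
  case (Cons c u)
  then obtain y where y: "represents m u (N - c * polygonal m y)" by auto
  from Cons.IH[OF y] Cons.prems obtain v where nonneg: "0 \<le> N - c * polygonal m y" and v: "mset v \<subseteq># mset u"
    "represents m v (N - c * polygonal m y)" "int (length v) \<le> N - c * polygonal m y"
    "\<forall>d\<in>set v. d \<le> N - c * polygonal m y" by auto
  show ?case
  proof (cases "polygonal m y = 0")
    case True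
    have "mset v \<subseteq># mset (c # u)" by (rule subset_mset.order_trans[OF v(1)]) simp
    then show ?thesis using True nonneg v by auto
  next
    case False
    then have "1 \<le> polygonal m y" using polygonal_nonneg[OF m, of y] by simp
    then have c: "c \<le> c * polygonal m y" "1 \<le> c" using Cons.prems mult_left_mono[of 1 "polygonal m y" c] by auto
    have cN: "c \<le> N" "N - c * polygonal m y \<le> N" using c nonneg by linarith+
    have "represents m (c # v) N" using v(2) by auto
    moreover have "mset (c # v) \<subseteq># mset (c # u)" using v(1) by simp
    moreover have "int (length (c # v)) \<le> N" using v(3) c unfolding list.size of_nat_add of_nat_Suc of_nat_0 by linarith
    moreover have "\<forall>d\<in>set (c # v). d \<le> N" using v(4) cN by force
    moreover have "0 \<le> N" using cN(1) c(2) by linarith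
    ultimately show ?thesis by blast
  qed
qed

text \<open>
  Otherwise a path of the escalator tree, whose nodes are multisets of coefficients contained in
  counterexamples for every bound, extends forever: the least exception of a node is represented
  by a counterexample using boundedly many bounded further coefficients.
\<close>

theorem finiteness_bound:
  assumes m: "m \<ge> 3" and n: "n \<ge> 0"
  shows "\<exists>B::nat. \<forall>a. (\<forall>c\<in>set a. c > 0) \<longrightarrow> (\<forall>t\<in>{n..int B}. represents m a t) \<longrightarrow> (\<forall>t\<ge>n. represents m a t)"
proof (rule ccontr)
  define bad where "bad = (\<lambda>(B::nat) a. (\<forall>c\<in>set a. c > 0) \<and> (\<forall>t\<in>{n..int B}. represents m a t) \<and> (\<exists>t\<ge>n. \<not> represents m a t))"
  assume "\<not> ?thesis"
  then have ex_bad: "\<exists>a. bad B a" for B unfolding bad_def by blast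
  have bad_mono: "bad B' a \<Longrightarrow> B \<le> B' \<Longrightarrow> bad B a" for B B' a unfolding bad_def by auto
  define good where "good = (\<lambda>w. \<forall>B. \<exists>a. bad B a \<and> mset w \<subseteq># mset a)"
  \<comment> \<open>For a good node the \<open>LEAST\<close> is attained: a counterexample
    containing the node misses some t >= n, and then so does the node.\<close>
  define truant where "truant = (\<lambda>w. n + int (LEAST j. \<not> represents m w (n + int j)))"
  have exception: "\<exists>t\<ge>n. \<not> represents m w t" if "good w" for w
    using that represents_submset unfolding good_def bad_def by meson
  have truant: "\<not> represents m w (truant w)" if w: "good w" for w
  proof -
    obtain t where "t \<ge> n" "\<not> represents m w t" using exception[OF w] by blast
    then have "\<not> represents m w (n + int (nat (t - n)))" by simp
    then show ?thesis unfolding truant_def by (rule LeastI)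
  qed
  have pos: "c > 0" if w: "good w" "c \<in> set w" for w c
  proof -
    obtain a where a: "bad 0 a" "mset w \<subseteq># mset a" using w(1) unfolding good_def by blast
    have "c \<in> set a" using a(2) w(2) by (metis mset_subset_eqD set_mset_mset)
    then show ?thesis using a(1) unfolding bad_def by blast
  qed
  have step: "\<exists>v. good (w @ v) \<and> represents m (w @ v) (truant w)" if w: "good w" for w
  proof -
    let ?t = "truant w"
    have t: "n \<le> ?t" unfolding truant_def by simp
    define Q where "Q = (\<lambda>v B. represents m (w @ v) ?t \<and> (\<exists>a. bad B a \<and> mset (w @ v) \<subseteq># mset a))"
    let ?V = "{v. set v \<subseteq> {1..?t} \<and> length v \<le> nat ?t}"
    have ex: "\<exists>v\<in>?V. Q v B" for B
    proof -
      obtain a where "bad (B + nat ?t) a" and sub: "mset w \<subseteq># mset a"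
        using w unfolding good_def by blast
      then have a: "bad B a" "represents m a ?t" "\<forall>c\<in>set a. c > 0"
        using t by (auto simp: bad_def)
      obtain u where u: "mset u = mset a - mset w" using ex_mset by blast
      then have wu: "mset (w @ u) = mset a" using sub by simp
      then have set_wu: "set (w @ u) = set a" by (rule mset_eq_setD)
      have "represents m (w @ u) ?t" using represents_mset a(2) wu by metis
      then obtain s where s: "represents m w s" "represents m u (?t - s)" unfolding represents_append by blast
      have "0 \<le> s" using represents_bounded_part[OF m s(1)] set_wu a(3) by auto
      obtain v where v: "mset v \<subseteq># mset u" "represents m v (?t - s)" "int (length v) \<le> ?t - s" "\<forall>c\<in>set v. c \<le> ?t - s"
        using represents_bounded_part[OF m s(2)] set_wu a(3) by auto
      have sub': "mset (w @ v) \<subseteq># mset a" using v(1) wu by (metis mset_append subset_mset.add_left_mono)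
      then have "set (w @ v) \<subseteq> set a" by (metis mset_subset_eqD set_mset_mset subsetI)
      then have "\<forall>c\<in>set v. 1 \<le> c" using a(3) by (auto simp: subset_iff int_one_le_iff_zero_less)
      then have "v \<in> ?V" using v(3,4) \<open>0 \<le> s\<close> by fastforce
      moreover have "represents m (w @ v) ?t" unfolding represents_append using s(1) v(2) by blast
      ultimately show ?thesis unfolding Q_def using a(1) sub' by blast
    qed
    \<comment> \<open>Each B admits some extension from the finite set \<open>?V\<close>, and
      \<open>Q v\<close> passes to smaller bounds; if every v failed at some B, all would fail at
      one common B.\<close>
    have "\<exists>v\<in>?V. \<forall>B. Q v B"
    proof (rule ccontr)
      assume "\<not> ?thesis"
      then have none: "\<And>v. v \<in> ?V \<Longrightarrow> \<exists>B. \<not> Q v B" by blast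
      have "\<exists>B\<ge>0. \<forall>v\<in>?V. \<not> Q v B"
      proof (rule uniform_finite_choice[OF _ none])
        show "finite ?V" by (rule finite_lists_length_le) simp
        show "\<not> Q v B'" if "\<not> Q v B" "B \<le> B'" for v B B'
          using that bad_mono unfolding Q_def by blast
      qed
      then show False using ex by blast
    qed
    then show ?thesis unfolding Q_def good_def by blast
  qed
  have "good []" unfolding good_def using ex_bad by simp
  obtain W where W: "\<And>k. good (W k)"
    "\<And>k. (\<exists>v. W (Suc k) = W k @ v) \<and> represents m (W (Suc k)) (truant (W k))"
    using dependent_nat_choice[of "\<lambda>_. good" "\<lambda>_ w w'. (\<exists>v. w' = w @ v) \<and> represents m w' (truant w)"]
      \<open>good []\<close> step by (metis (no_types, lifting))
  have prefix: "\<exists>v. W (k + l) = W k @ v" for k l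
  proof (induction l)
    case (Suc l)
    then show ?case using W(2)[of "k + l"] by auto
  qed simp
  have len: "k \<le> length (W k)" for k
  proof (induction k)
    case (Suc k)
    obtain v where v: "W (Suc k) = W k @ v" using W(2) by blast
    have "v \<noteq> []" using v W(2)[of k] truant[OF W(1)[of k]] by auto
    then have "1 \<le> length v" by (cases v) auto
    then show ?case unfolding v length_append using Suc by linarith
  qed simp
  \<comment> \<open>\<open>W (Suc i)\<close> has length at least i + 1, so the entry exists; later
    lists extend it, so a is the common limit of all \<open>W k\<close>.\<close>
  define a where "a = (\<lambda>i. W (Suc i) ! i)"
  have aW: "a i = W k ! i" if "i < length (W k)" for i k
  proof (cases "k \<le> Suc i")
    case True
    then obtain v where "W (Suc i) = W k @ v" using prefix[of k "Suc i - k"] by auto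
    then show ?thesis using that unfolding a_def by (simp add: nth_append)
  next
    case False
    then obtain v where "W k = W (Suc i) @ v" using prefix[of "Suc i" "k - Suc i"] by auto
    then show ?thesis using len[of "Suc i"] unfolding a_def by (simp add: nth_append)
  qed
  have form: "represents m (W k) N \<longleftrightarrow> (\<exists>x. form_value m a (length (W k)) x = N)" for k N
    unfolding represents_iff_form_value form_value_def using aW by simp
  have apos: "a i > 0" for i
    using pos[OF W(1)[of "Suc i"], of "a i"] len[of "Suc i"] unfolding a_def by simp
  have initial: "\<forall>t. n \<le> t \<and> t < n + int j \<longrightarrow> represents m (W j) t" for j
  proof (induction j)
    case (Suc j)
    obtain v where v: "W (Suc j) = W j @ v" using W(2) by blast
    show ?case
    proof (intro allI impI)
      fix t assume t: "n \<le> t \<and> t < n + int (Suc j)"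
      show "represents m (W (Suc j)) t"
      proof (cases "represents m (W j) t")
        case True
        then show ?thesis unfolding v by (rule represents_append_left)
      next
        case False
        then have tj: "t = n + int j" using Suc t by force
        have "(LEAST i. \<not> represents m (W j) (n + int i)) = j"
        proof (rule Least_equality)
          show "j \<le> i" if "\<not> represents m (W j) (n + int i)" for i
            by (rule ccontr) (use Suc that in auto)
        qed (use False tj in simp)
        then have "truant (W j) = t" unfolding truant_def tj by simp
        then show ?thesis using W(2)[of j] by simp
      qed
    qed
  qed auto
  have "\<exists>k x. form_value m a k x = N" if "N \<ge> n" for N
  proof -
    have "N < n + int (Suc (nat (N - n)))" using that by simp
    then have "represents m (W (Suc (nat (N - n)))) N" using initial that by blast
    then show ?thesis using form by blast
  qed
  then obtain k where k: "\<And>N. N \<ge> n \<Longrightarrow> \<exists>x. form_value m a k x = N"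
    using finite_prefix_suffices[of m a n] m apos by blast
  have "represents m (W k) N" if "N \<ge> n" for N
    using k[OF that] form_value_extend[OF len[of k], of m a] form by metis
  then show False using exception[OF W(1)[of k]] by blast
qed

section \<open>Return to the vectors of the theorem\<close>

lemma mem_nonzero_represented:
  "N \<in> nonzero_represented m a \<longleftrightarrow> represents m a N \<and> N \<noteq> 0"
proof -
  have "(\<exists>s. N = (\<Sum>i<length a. a ! i * s i) \<and> (\<forall>i<length a. s i \<in> gen_polygonal_numbers m)) \<longleftrightarrow>
      (\<exists>x. form_value m ((!) a) (length a) x = N)"
  proof
    assume "\<exists>s. N = (\<Sum>i<length a. a ! i * s i) \<and> (\<forall>i<length a. s i \<in> gen_polygonal_numbers m)"
    then obtain s where s: "N = (\<Sum>i<length a. a ! i * s i)" "\<forall>i<length a. s i \<in> range (polygonal m)"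
      unfolding gen_polygonal_numbers_def by blast
    then have "\<forall>i. \<exists>x. i < length a \<longrightarrow> s i = polygonal m x" by auto
    then obtain x where "\<And>i. i < length a \<Longrightarrow> s i = polygonal m (x i)" by metis
    then show "\<exists>x. form_value m ((!) a) (length a) x = N"
      unfolding form_value_def s(1) by (intro exI[of _ x]) simp
  next
    assume "\<exists>x. form_value m ((!) a) (length a) x = N"
    then obtain x where "N = (\<Sum>i<length a. a ! i * polygonal m (x i))"
      unfolding form_value_def by blast
    then show "\<exists>s. N = (\<Sum>i<length a. a ! i * s i) \<and> (\<forall>i<length a. s i \<in> gen_polygonal_numbers m)"
      unfolding gen_polygonal_numbers_def by (intro exI[of _ "\<lambda>i. polygonal m (x i)"]) simp
  qed
  then show ?thesis
    unfolding nonzero_represented_def represents_iff_form_value by simp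
qed

theorem theorem3p3:
  fixes m n :: int
  assumes "m \<ge> 3" and "n \<ge> 1"
  shows "\<exists>CS :: int set. finite CS \<and> (\<forall>c\<in>CS. 0 < c) \<and>
    (\<forall>a\<in>coeff_vectors.
       nonzero_represented m a = {n..} \<longleftrightarrow>
       nonzero_represented m a \<inter> {1..n - 1} = {} \<and> CS \<subseteq> nonzero_represented m a)"
proof -
  \<comment> \<open>CS will be the interval from n to B. That nothing below n is represented follows
    from the other condition, because values are nonnegative by
    \<open>represents_bounded_part\<close>.\<close>
  obtain B :: nat where B: "\<And>a t. \<forall>c\<in>set a. c > 0 \<Longrightarrow> \<forall>t\<in>{n..int B}. represents m a t \<Longrightarrow> t \<ge> n \<Longrightarrow> represents m a t"
    using finiteness_bound[of m n] assms order_trans[OF zero_le_one assms(2)] by blast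
  have "nonzero_represented m a = {n..} \<longleftrightarrow>
       nonzero_represented m a \<inter> {1..n - 1} = {} \<and> {n..int B} \<subseteq> nonzero_represented m a"
    if "a \<in> coeff_vectors" for a
  proof
    have pos: "\<forall>c\<in>set a. c > 0"
      using that unfolding coeff_vectors_def coeff_vectors_of_length_def by auto
    assume *: "nonzero_represented m a \<inter> {1..n - 1} = {} \<and> {n..int B} \<subseteq> nonzero_represented m a"
    then have "\<forall>t\<in>{n..int B}. represents m a t" by (auto simp: mem_nonzero_represented)
    then have "t \<in> nonzero_represented m a" if "t \<ge> n" for t
      using B[OF pos] that assms(2) by (simp add: mem_nonzero_represented)
    moreover have "t \<ge> n" if t: "t \<in> nonzero_represented m a" for t
    proof -
      have "0 \<le> t" "t \<noteq> 0"
        using t represents_bounded_part[OF assms(1) _ pos] by (auto simp: mem_nonzero_represented)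
      then show ?thesis using * t by fastforce
    qed
    ultimately show "nonzero_represented m a = {n..}" by blast
  qed auto
  then show ?thesis
    using assms(2) by (intro exI[of _ "{n..int B}"]) auto
qed

end
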